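(* Let $R>0$, $p>1$, let $a\in\mathcal{C}([0,R];\mathbb{R})$ satisfy $a(x)>0$ for all $x\in[0,R]$, and let $\mathcal{B}\in\{\mathcal{D},\mathcal{N},\mathcal{R}_\beta:\beta\in\mathbb{R}\}$ be a boundary operator at $x=0$. For $\lambda\in\mathbb{R}$ consider the singular boundary value problem $$-u''=\lambda u-a(x)|u|^{p-1}u\ \text{ in }[0,R),\qquad \mathcal{B}u(0)=0,\qquad u(R)=+\infty. \tag{P}$$ Then: (a) For every $\lambda\in\mathbb{R}$, (P) possesses a minimal and a maximal positive solution, denoted by $L^{\rm min}_\lambda$ and $L^{\rm max}_\lambda$ respectively, in the sense that any other positive solution $L$ of (P) satisfies $$L^{\rm min}_\lambda(x)\leq L(x)\leq L^{\rm max}_\lambda(x)\quad\text{for all }x\in[0,R).$$ (b) $\lim_{\lambda\uparrow+\infty}L^{\rm min}_\lambda=+\infty$ uniformly in compact subsets of $[0,R)$, unless $\mathcal{B}=\mathcal{D}$, in which case $L^{\rm min}_\lambda(0)=0$ for all $\lambda\in\mathbb{R}$. (c) $\lim_{\lambda\downarrow-\infty}L^{\rm max}_\lambda=0$ uniformly in compact subsets of $[0,R)$. (d) If, in addition, $a$ is non-increasing in $[0,R]$, $\lambda\geq0$ and $\mathcal{B}\in\{\mathcal{D},\mathcal{N},\mathcal{R}_\beta:\beta<0\}$, then $L^{\rm min}_\lambda=L^{\rm max}_\lambda$. Thus, in such cases, (P) has a unique positive solution.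
   Context: Boundary operators at $x=0$: $\mathcal{D}u(0)=u(0)$ (Dirichlet), $\mathcal{N}u(0)=-u'(0)$ (Neumann), $\mathcal{R}_\beta u(0)=-u'(0)+\beta u(0)$ (Robin), where $\beta\in\mathbb{R}$ may have any sign; $\mathcal{R}_0=\mathcal{N}$. The condition $u(R)=+\infty$ means $\lim_{x\uparrow R}u(x)=+\infty$. A positive solution is a function $u\in\mathcal{C}^2([0,R);\mathbb{R})$ satisfying the problem with $u\geq 0$, $u\not\equiv0$ (equivalently, $u(x)>0$ for all $x\in(0,R)$). *)

theory Defs
  imports "HOL-Analysis.Analysis"
begin

text \<open>
  Functions on \<open>[0,R)\<close> are total functions \<open>real \<Rightarrow> real\<close> of which only the values on \<open>{0..<R}\<close>
  matter. Derivatives are taken within \<open>{0..<R}\<close>, hence one-sided at \<open>0\<close> and two-sided elsewhere.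
\<close>

definition D1 :: "real \<Rightarrow> (real \<Rightarrow> real) \<Rightarrow> real \<Rightarrow> real" where
  "D1 R u x = vector_derivative u (at x within {0..<R})"

definition D2 :: "real \<Rightarrow> (real \<Rightarrow> real) \<Rightarrow> real \<Rightarrow> real" where
  "D2 R u = D1 R (D1 R u)"

definition C2_on :: "real \<Rightarrow> (real \<Rightarrow> real) \<Rightarrow> bool" where
  "C2_on R u \<longleftrightarrow>
     u differentiable_on {0..<R} \<and>
     D1 R u differentiable_on {0..<R} \<and>
     continuous_on {0..<R} (D2 R u)"

definition dirichlet :: "(real \<Rightarrow> real) \<Rightarrow> real" where
  "dirichlet u = u 0"

definition neumann :: "real \<Rightarrow> (real \<Rightarrow> real) \<Rightarrow> real" where
  "neumann R u = - D1 R u 0"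

definition robin :: "real \<Rightarrow> real \<Rightarrow> (real \<Rightarrow> real) \<Rightarrow> real" where
  "robin R \<beta> u = - D1 R u 0 + \<beta> * u 0"

lemma robin_0: "robin R 0 = neumann R"
  by (simp add: robin_def neumann_def fun_eq_iff)

definition positive_solution ::
  "real \<Rightarrow> real \<Rightarrow> (real \<Rightarrow> real) \<Rightarrow> ((real \<Rightarrow> real) \<Rightarrow> real) \<Rightarrow> real \<Rightarrow> (real \<Rightarrow> real) \<Rightarrow> bool" where
  "positive_solution R p a B lam u \<longleftrightarrow>
     C2_on R u \<and>
     (\<forall>x\<in>{0..<R}. - D2 R u x = lam * u x - a x * \<bar>u x\<bar> powr (p - 1) * u x) \<and>
     B u = 0 \<and>
     filterlim u at_top (at_left R) \<and>
     (\<forall>x\<in>{0..<R}. 0 \<le> u x) \<and>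
     (\<exists>x\<in>{0..<R}. u x \<noteq> 0)"

definition minimal_solution ::
  "real \<Rightarrow> real \<Rightarrow> (real \<Rightarrow> real) \<Rightarrow> ((real \<Rightarrow> real) \<Rightarrow> real) \<Rightarrow> real \<Rightarrow> (real \<Rightarrow> real) \<Rightarrow> bool" where
  "minimal_solution R p a B lam u \<longleftrightarrow>
     positive_solution R p a B lam u \<and>
     (\<forall>L. positive_solution R p a B lam L \<longrightarrow> (\<forall>x\<in>{0..<R}. u x \<le> L x))"

definition maximal_solution ::
  "real \<Rightarrow> real \<Rightarrow> (real \<Rightarrow> real) \<Rightarrow> ((real \<Rightarrow> real) \<Rightarrow> real) \<Rightarrow> real \<Rightarrow> (real \<Rightarrow> real) \<Rightarrow> bool" where
  "maximal_solution R p a B lam u \<longleftrightarrow>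
     positive_solution R p a B lam u \<and>
     (\<forall>L. positive_solution R p a B lam L \<longrightarrow> (\<forall>x\<in>{0..<R}. L x \<le> u x))"

definition uniformly_to_infinity ::
  "real set \<Rightarrow> (real \<Rightarrow> real \<Rightarrow> real) \<Rightarrow> real filter \<Rightarrow> bool" where
  "uniformly_to_infinity K f F \<longleftrightarrow> (\<forall>M. \<forall>\<^sub>F lam in F. \<forall>x\<in>K. M \<le> f lam x)"

end

(*
  Everything rests on one comparison principle.  If u is a subsolution, w a supersolution and
  u > w on a maximal interval, the Wronskian u' w - u w' is strictly increasing there, because
  s |-> a s^(p-1) - lam is increasing, while its values at the two ends are >= 0 and <= 0.

  Existence: monotone iteration for the Green operator gives the solution with end value u(r) = M,
  and the limit M -> infinity, controlled by the Keller-Osserman supersolution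
  N (r - x)^(-2/(p-1)) e^(-m x), is the least solution blowing up at r.  For r = R it is the minimal
  solution; the decreasing limit r -> R gives the maximal one.

  (b) A e^(beta x) is a bounded subsolution as soon as a (A e^(beta x))^(p-1) <= lam.
  (c) A (e^(kx) + 3 e^(-kx)), k = sqrt (-lam), is a supersolution once k >= 2 |beta|.
  (d) If L is a solution, s^(2/(p-1)) L(s x) with s > 1 is a supersolution blowing up at R/s < R,
      hence lies above every solution; let s -> 1.
*)
theory Submission
  imports Defs "HOL-Real_Asymp.Real_Asymp"
begin

section \<open>Comparison and limits for second-order equations\<close>

text \<open>The Wronskian argument uses only that \<open>F lam x s / s\<close> increases with
  \<open>s\<close> and that the supersolution is positive; the boundary condition enters solely
  through the sign of the Wronskian at 0, so all boundary operators are treated at once. The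
  obstacle is the singular end: two functions blowing up at the same point satisfy no known
  inequality near it, so a comparison cannot be started there. A bounded function, in contrast, is
  eventually below one that blows up. Hence one side of each comparison is kept bounded: by finite
  end values for the minimal solution, by majorants with an earlier blow-up point for the maximal
  solution and in (c), and by a rescaling that pulls the blow-up point inside \<open>[0,R)\<close>
  in (d).\<close>

lemma wronskian_comparison:
  fixes u u' u'' w w' w'' :: "real \<Rightarrow> real"
  assumes u: "\<And>x. x \<in> {0..b} \<Longrightarrow> (u has_real_derivative u' x) (at x within {0..b})"
    and u': "\<And>x. x \<in> {0..b} \<Longrightarrow> (u' has_real_derivative u'' x) (at x within {0..b})"
    and w: "\<And>x. x \<in> {0..b} \<Longrightarrow> (w has_real_derivative w' x) (at x within {0..b})"
    and w': "\<And>x. x \<in> {0..b} \<Longrightarrow> (w' has_real_derivative w'' x) (at x within {0..b})"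
    and w0: "\<And>x. x \<in> {0..b} \<Longrightarrow> 0 \<le> w x"
    and bc: "u 0 * w' 0 \<le> u' 0 * w 0"
    and ub: "u b \<le> w b"
    and gap: "\<And>x. \<lbrakk>0 < x; x < b; w x < u x\<rbrakk> \<Longrightarrow> u x * w'' x < u'' x * w x"
    and x: "x \<in> {0..b}"
  shows "u x \<le> w x"
proof (rule ccontr)
  assume "\<not> u x \<le> w x"
  then have ux: "w x < u x" by simp
  with ub x have xb: "0 \<le> x" "x < b" by (auto simp: less_le)
  let ?f = "\<lambda>x. u x - w x"
  let ?W = "\<lambda>x. u' x * w x - u x * w' x"
  have f: "(?f has_real_derivative u' x - w' x) (at x within {0..b})" if "x \<in> {0..b}" for x
    by (intro derivative_intros u w that)
  have W: "(?W has_real_derivative u'' x * w x - u x * w'' x) (at x within {0..b})" if "x \<in> {0..b}" for x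
    by (rule derivative_eq_intros u[OF that] w[OF that] u'[OF that] w'[OF that] refl)+ (simp add: algebra_simps)
  have fc: "continuous_on {0..b} ?f" by (rule DERIV_continuous_on[OF f])
  have Wc: "continuous_on {0..b} ?W" by (rule DERIV_continuous_on[OF W])
  \<comment> \<open>The first zero of the gap to the right of \<open>x\<close>; it exists because
    \<open>u b \<le> w b\<close>.\<close>
  obtain t where t: "x < t" "t \<le> b" "?f t = 0" "\<And>y. x \<le> y \<Longrightarrow> y < t \<Longrightarrow> 0 < ?f y"
  proof -
    let ?S = "{y \<in> {x..b}. ?f y \<le> 0}"
    have "closed ?S"
      by (rule continuous_on_closed_Collect_le)
        (use xb in \<open>auto intro: continuous_on_subset[OF fc]\<close>)
    moreover have "b \<in> ?S" using xb ub by auto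
    moreover have bdd: "bdd_below ?S" by (auto intro: bdd_belowI[of _ x])
    ultimately have I: "Inf ?S \<in> ?S" by (intro closed_contains_Inf) auto
    have less: "0 < ?f y" if "x \<le> y" "y < Inf ?S" for y
    proof (rule ccontr)
      assume "\<not> 0 < ?f y"
      with that I have "y \<in> ?S" by auto
      with cInf_lower[OF this bdd] that show False by simp
    qed
    have "\<exists>y\<ge>x. y \<le> Inf ?S \<and> ?f y = 0"
      by (rule IVT2') (use I ux xb in \<open>auto intro: continuous_on_subset[OF fc]\<close>)
    then obtain y where y: "x \<le> y" "y \<le> Inf ?S" "?f y = 0" by blast
    with less[of y] have "y = Inf ?S" by force
    with y I ux show ?thesis by (intro that[of y]) (use less in \<open>auto simp: less_le\<close>)
  qed
  \<comment> \<open>The last zero of the gap to the left of \<open>x\<close>. If the gap never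
    closes there, \<open>s = 0\<close>, and the boundary hypothesis \<open>bc\<close> replaces the
    slope argument.\<close>
  obtain s where s: "0 \<le> s" "s \<le> x" "s = 0 \<or> ?f s = 0" "\<And>y. s < y \<Longrightarrow> y \<le> x \<Longrightarrow> 0 < ?f y"
  proof (cases "\<exists>y\<in>{0..x}. ?f y \<le> 0")
    case False
    then show ?thesis using xb by (intro that[of 0]) (auto simp: not_le)
  next
    case True
    let ?S = "{y \<in> {0..x}. ?f y \<le> 0}"
    have "closed ?S"
      by (rule continuous_on_closed_Collect_le)
        (use xb in \<open>auto intro: continuous_on_subset[OF fc]\<close>)
    moreover have "?S \<noteq> {}" using True by blast
    moreover have bdd: "bdd_above ?S" by (auto intro: bdd_aboveI[of _ x])
    ultimately have I: "Sup ?S \<in> ?S" by (intro closed_contains_Sup) auto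
    have less: "0 < ?f y" if "Sup ?S < y" "y \<le> x" for y
    proof (rule ccontr)
      assume "\<not> 0 < ?f y"
      with that I have "y \<in> ?S" by auto
      with cSup_upper[OF this bdd] that show False by simp
    qed
    have "\<exists>y\<ge>Sup ?S. y \<le> x \<and> ?f y = 0"
      by (rule IVT') (use I ux xb in \<open>auto intro: continuous_on_subset[OF fc]\<close>)
    then obtain y where y: "Sup ?S \<le> y" "y \<le> x" "?f y = 0" by blast
    with less[of y] have "y = Sup ?S" by force
    with y I show ?thesis by (intro that[of y]) (use less in auto)
  qed
  have pos: "0 < ?f y" if "s < y" "y < t" for y
    using s(4)[of y] t(4)[of y] that by linarith
  have ut: "u' t - w' t \<le> 0"
  proof (rule ccontr)
    assume "\<not> u' t - w' t \<le> 0"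
    then obtain e where "e > 0" and e: "\<And>h. h > 0 \<Longrightarrow> t - h \<in> {0..b} \<Longrightarrow> h < e \<Longrightarrow> ?f (t - h) < ?f t"
      using has_real_derivative_pos_inc_left[OF f[of t]] t s by force
    define h where "h = min (e/2) (t - x)"
    have "?f (t - h) < ?f t" using \<open>e > 0\<close> t xb by (intro e) (auto simp: h_def)
    moreover have "0 < ?f (t - h)" using \<open>e > 0\<close> t by (intro t(4)) (auto simp: h_def)
    ultimately show False using t by simp
  qed
  \<comment> \<open>Where the gap vanishes, the Wronskian is \<open>w\<close> times the slope of the
    gap.\<close>
  have "?W t \<le> 0"
  proof -
    have "?W t = w t * (u' t - w' t)" using t by (simp add: algebra_simps)
    also have "\<dots> \<le> 0" using ut w0[of t] t xb by (intro mult_nonneg_nonpos) auto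
    finally show ?thesis .
  qed
  moreover have "0 \<le> ?W s"
  proof (cases "s = 0")
    case True then show ?thesis using bc by simp
  next
    case False
    then have fs: "?f s = 0" using s by auto
    have us: "0 \<le> u' s - w' s"
    proof (rule ccontr)
      assume "\<not> 0 \<le> u' s - w' s"
      then obtain e where "e > 0" and e: "\<And>h. h > 0 \<Longrightarrow> s + h \<in> {0..b} \<Longrightarrow> h < e \<Longrightarrow> ?f (s + h) < ?f s"
        using has_real_derivative_neg_dec_right[OF f[of s]] s xb by force
      define h where "h = min (e/2) ((t - s)/2)"
      have st: "s < t" using s t by linarith
      have "h \<le> (t - s)/2" unfolding h_def by (rule min.cobounded2)
      moreover have "h > 0" "h < e" using \<open>e > 0\<close> st by (auto simp: h_def)
      ultimately have h: "h > 0" "h < e" "h \<le> (t - s)/2" by auto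
      then have "?f (s + h) < ?f s" using s t by (intro e) auto
      moreover have "0 < ?f (s + h)" using h by (intro pos) (auto simp: field_simps)
      ultimately show False using fs by simp
    qed
    have "?W s = w s * (u' s - w' s)" using fs by (simp add: algebra_simps)
    then show ?thesis using us w0[of s] s xb by simp
  qed
  moreover have "?W s < ?W t"
  proof (rule DERIV_pos_imp_increasing_open[where f = ?W])
    show "s < t" using s t by simp
    show "continuous_on {s..t} ?W" using s t by (intro continuous_on_subset[OF Wc]) auto
    fix y assume y: "s < y" "y < t"
    then have yb: "0 < y" "y < b" using s t by auto
    have "(?W has_real_derivative u'' y * w y - u y * w'' y) (at y)"
      using W[of y] yb at_within_interior[of y "{0..b}"] by (simp add: interior_atLeastAtMost_real)
    moreover have "0 < u'' y * w y - u y * w'' y" using gap[of y] yb pos[of y] y by auto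
    ultimately show "\<exists>z. (?W has_real_derivative z) (at y) \<and> 0 < z" by blast
  qed
  ultimately show False by linarith
qed

text \<open>Nothing is assumed about convergence of the first derivatives. Integrating the bounded
  \<open>g n\<close> twice, with dominated convergence, gives the limit of
  \<open>f n x - f n 0 - x * f' n 0\<close>; its value at \<open>x = b\<close> then forces the
  slopes at 0 to converge. Continuity of \<open>G\<close> is a premise inside the conclusion because
  in the applications \<open>G\<close> is built from \<open>F\<close>, whose continuity only comes
  out of the lemma.\<close>

lemma second_derivative_limit:
  fixes f f' g :: "nat \<Rightarrow> real \<Rightarrow> real" and F G :: "real \<Rightarrow> real"
  assumes b: "0 < b"
    and f: "\<And>n x. x \<in> {0..b} \<Longrightarrow> (f n has_real_derivative f' n x) (at x within {0..b})"
    and f': "\<And>n x. x \<in> {0..b} \<Longrightarrow> (f' n has_real_derivative g n x) (at x within {0..b})"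
    and C: "\<And>n x. x \<in> {0..b} \<Longrightarrow> \<bar>g n x\<bar> \<le> C"
    and F: "\<And>x. x \<in> {0..b} \<Longrightarrow> (\<lambda>n. f n x) \<longlonglongrightarrow> F x"
    and G: "\<And>x. x \<in> {0..b} \<Longrightarrow> (\<lambda>n. g n x) \<longlonglongrightarrow> G x"
  shows "\<exists>D. \<forall>x\<in>{0..b}. (\<lambda>n. f' n x) \<longlonglongrightarrow> D x \<and>
     (F has_real_derivative D x) (at x within {0..b}) \<and>
     (continuous_on {0..b} G \<longrightarrow> (D has_real_derivative G x) (at x within {0..b}))"
proof -
  have gi: "(g n has_integral f' n x - f' n 0) {0..x}" if "x \<in> {0..b}" for n x
    using that by (intro fundamental_theorem_of_calculus)
      (auto simp flip: has_real_derivative_iff_has_vector_derivative intro!: DERIV_subset[OF f'])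
  have fi: "(f' n has_integral f n x - f n 0) {0..x}" if "x \<in> {0..b}" for n x
    using that by (intro fundamental_theorem_of_calculus)
      (auto simp flip: has_real_derivative_iff_has_vector_derivative intro!: DERIV_subset[OF f])
  define I where "I x = integral {0..x} G" for x
  have gI: "g n integrable_on {0..x}" if "x \<in> {0..b}" for n x
    by (rule has_integral_integrable[OF gi[OF that]])
  have GI: "G integrable_on {0..x}" "(\<lambda>n. f' n x - f' n 0) \<longlonglongrightarrow> I x" if "x \<in> {0..b}" for x
  proof -
    have le: "norm (g n y) \<le> C" and lim: "(\<lambda>n. g n y) \<longlonglongrightarrow> G y" if "y \<in> {0..x}" for n y
      using that \<open>x \<in> {0..b}\<close> C G by auto
    note * = dominated_convergence[OF gI[OF that] integrable_const_ivl[of C 0 x] le lim]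
    then show "G integrable_on {0..x}" by blast
    show "(\<lambda>n. f' n x - f' n 0) \<longlonglongrightarrow> I x"
      using *(2) integral_unique[OF gi[OF that]] by (simp add: I_def)
  qed
  have Ic: "continuous_on {0..b} I"
    unfolding I_def using GI(1)[of b] b by (intro indefinite_integral_continuous_1) auto
  have hi: "((\<lambda>t. f' n t - f' n 0) has_integral f n x - f n 0 - x * f' n 0) {0..x}" if "x \<in> {0..b}" for n x
    using has_integral_diff[OF fi[OF that] has_integral_const_real[of "f' n 0" 0 x]] that by simp
  have Ib: "\<bar>f' n x - f' n 0\<bar> \<le> \<bar>C\<bar> * b" if "x \<in> {0..b}" for n x
  proof -
    have le: "norm (g n y) \<le> \<bar>C\<bar>" if "y \<in> {0..x} - {}" for y
      using C[of y n] that \<open>x \<in> {0..b}\<close> by auto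
    have "norm (f' n x - f' n 0) \<le> \<bar>C\<bar> * measure lborel {0..x}"
      by (rule has_integral_bound_real[OF abs_ge_zero finite.emptyI gi[OF that] le])
    also have "\<dots> \<le> \<bar>C\<bar> * b" using that by (auto intro!: mult_left_mono)
    finally show ?thesis by simp
  qed
  have J: "(\<lambda>n. f n x - f n 0 - x * f' n 0) \<longlonglongrightarrow> integral {0..x} I" if "x \<in> {0..b}" for x
  proof -
    have le: "norm (f' n y - f' n 0) \<le> \<bar>C\<bar> * b" and lim: "(\<lambda>n. f' n y - f' n 0) \<longlonglongrightarrow> I y"
      if "y \<in> {0..x}" for n y
      using that \<open>x \<in> {0..b}\<close> Ib GI by auto
    have "(\<lambda>n. integral {0..x} (\<lambda>t. f' n t - f' n 0)) \<longlonglongrightarrow> integral {0..x} I"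
      by (rule dominated_convergence(2)[OF has_integral_integrable[OF hi[OF that]] integrable_const_ivl[of "\<bar>C\<bar> * b" 0 x] le lim])
    then show ?thesis using integral_unique[OF hi[OF that]] by simp
  qed
  \<comment> \<open>The only initial slope compatible with the limit values at 0 and
    \<open>b\<close>.\<close>
  define d where "d = (F b - F 0 - integral {0..b} I) / b"
  have "(\<lambda>n. (f n b - f n 0 - (f n b - f n 0 - b * f' n 0)) / b) \<longlonglongrightarrow> d"
    unfolding d_def using b by (intro tendsto_intros J F) auto
  then have d: "(\<lambda>n. f' n 0) \<longlonglongrightarrow> d" using b by simp
  have FI: "F x = F 0 + d * x + integral {0..x} I" if "x \<in> {0..b}" for x
  proof -
    have "(\<lambda>n. f n x - f n 0 - x * f' n 0) \<longlonglongrightarrow> F x - F 0 - x * d"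
      using that b by (intro tendsto_intros F d) auto
    from LIMSEQ_unique[OF this J[OF that]] show ?thesis by (simp add: algebra_simps)
  qed
  show ?thesis
  proof (intro exI[of _ "\<lambda>x. d + I x"] ballI conjI impI)
    fix x assume x: "x \<in> {0..b}"
    show "(\<lambda>n. f' n x) \<longlonglongrightarrow> d + I x"
      using tendsto_add[OF d GI(2)[OF x]] by simp
    have "((\<lambda>x. F 0 + d * x + integral {0..x} I) has_real_derivative d + I x) (at x within {0..b})"
      by (auto intro!: derivative_eq_intros integral_has_real_derivative[OF Ic x])
    then show "(F has_real_derivative d + I x) (at x within {0..b})"
      by (rule has_field_derivative_transform_within[OF _ zero_less_one x]) (erule FI[symmetric])
    assume "continuous_on {0..b} G"
    then show "((\<lambda>x. d + I x) has_real_derivative G x) (at x within {0..b})"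
      unfolding I_def by (auto intro!: derivative_eq_intros integral_has_real_derivative x)
  qed
qed

text \<open>The energy \<open>u^2 + v^2\<close>, damped by \<open>exp (- (1 + |K|) * x)\<close>,
  cannot grow and starts at 0.\<close>

lemma gronwall_zero:
  fixes u v g :: "real \<Rightarrow> real"
  assumes u: "\<And>x. x \<in> {s..b} \<Longrightarrow> (u has_real_derivative v x) (at x within {s..b})"
    and v: "\<And>x. x \<in> {s..b} \<Longrightarrow> (v has_real_derivative g x) (at x within {s..b})"
    and g: "\<And>x. x \<in> {s..b} \<Longrightarrow> \<bar>g x\<bar> \<le> K * \<bar>u x\<bar>"
    and "u s = 0" "v s = 0" "s \<le> b"
  shows "u b = 0"
proof -
  let ?E = "\<lambda>x. ((u x)\<^sup>2 + (v x)\<^sup>2) * exp (- (1 + \<bar>K\<bar>) * x)"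
  let ?E' = "\<lambda>x. (2 * u x * v x + 2 * v x * g x - (1 + \<bar>K\<bar>) * ((u x)\<^sup>2 + (v x)\<^sup>2)) * exp (- (1 + \<bar>K\<bar>) * x)"
  have E: "(?E has_real_derivative ?E' x) (at x within {s..b})" if "x \<in> {s..b}" for x
    by (rule derivative_eq_intros u[OF that] v[OF that] refl)+ (simp add: algebra_simps)
  have E': "?E' x \<le> 0" if "x \<in> {s..b}" for x
  proof -
    have uv: "2 * (\<bar>u x\<bar> * \<bar>v x\<bar>) \<le> (u x)\<^sup>2 + (v x)\<^sup>2"
      using sum_squares_bound[of "\<bar>u x\<bar>" "\<bar>v x\<bar>"] by simp
    have "v x * g x \<le> \<bar>v x\<bar> * (K * \<bar>u x\<bar>)"
      using mult_left_mono[OF g[OF that], of "\<bar>v x\<bar>"] by (metis abs_ge_self abs_ge_zero abs_mult order_trans)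
    also have "\<dots> \<le> \<bar>v x\<bar> * (\<bar>K\<bar> * \<bar>u x\<bar>)" by (intro mult_left_mono mult_right_mono) auto
    finally have "2 * (v x * g x) \<le> \<bar>K\<bar> * (2 * (\<bar>u x\<bar> * \<bar>v x\<bar>))" by (simp add: mult_ac)
    also have "\<dots> \<le> \<bar>K\<bar> * ((u x)\<^sup>2 + (v x)\<^sup>2)" using uv by (intro mult_left_mono) auto
    finally have 1: "2 * (v x * g x) \<le> \<bar>K\<bar> * ((u x)\<^sup>2 + (v x)\<^sup>2)" .
    have "u x * v x \<le> \<bar>u x\<bar> * \<bar>v x\<bar>" by (metis abs_ge_self abs_mult)
    with 1 uv have "2 * u x * v x + 2 * v x * g x - (1 + \<bar>K\<bar>) * ((u x)\<^sup>2 + (v x)\<^sup>2) \<le> 0"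
      by (simp add: algebra_simps)
    then show ?thesis by (intro mult_nonpos_nonneg) auto
  qed
  have "?E b \<le> ?E s"
  proof (rule DERIV_nonpos_imp_decreasing_open[OF \<open>s \<le> b\<close>])
    show "continuous_on {s..b} ?E" by (rule DERIV_continuous_on[OF E])
    fix x assume x: "s < x" "x < b"
    then have "(?E has_real_derivative ?E' x) (at x)"
      using E[of x] at_within_interior[of x "{s..b}"] by (simp add: interior_atLeastAtMost_real)
    then show "\<exists>y. (?E has_real_derivative y) (at x) \<and> y \<le> 0" using E'[of x] x by auto
  qed
  also have "?E s = 0" using assms by simp
  finally show ?thesis
    by (simp add: mult_le_0_iff) (smt (verit) zero_le_power2 power2_eq_iff_nonneg zero_eq_power2 exp_gt_zero)
qed

section \<open>Sub- and supersolutions\<close>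

definition C2_derivs :: "real \<Rightarrow> (real \<Rightarrow> real) \<Rightarrow> (real \<Rightarrow> real) \<Rightarrow> (real \<Rightarrow> real) \<Rightarrow> bool" where
  "C2_derivs b u u' u'' \<longleftrightarrow>
     (\<forall>x\<in>{0..b}. (u has_real_derivative u' x) (at x within {0..b}) \<and>
                  (u' has_real_derivative u'' x) (at x within {0..b}))"

lemma C2_derivs_mono: 
  assumes C: "C2_derivs b u u' u''" and "b' \<le> b"
  shows "C2_derivs b' u u' u''"
  unfolding C2_derivs_def
proof (intro ballI conjI)
  fix x assume "x \<in> {0..b'}"
  then have x: "x \<in> {0..b}" and s: "{0..b'} \<subseteq> {0..b}" using \<open>b' \<le> b\<close> by auto
  show "(u has_real_derivative u' x) (at x within {0..b'})"
    using C x by (intro DERIV_subset[OF _ s]) (simp add: C2_derivs_def)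
  show "(u' has_real_derivative u'' x) (at x within {0..b'})"
    using C x by (intro DERIV_subset[OF _ s]) (simp add: C2_derivs_def)
qed

lemma C2_derivs_continuous:
  assumes "C2_derivs b u u' u''" shows "continuous_on {0..b} u" "continuous_on {0..b} u'"
  using assms unfolding C2_derivs_def by (meson DERIV_continuous_on)+

text \<open>
  The condition \<open>d * u' 0 = c * u 0\<close> is the Robin condition for \<open>d = 1\<close>, \<open>c = \<beta>\<close> and the
  Dirichlet condition for \<open>d = 0\<close>, \<open>c = 1\<close>.
\<close>

locale blowup_problem =
  fixes R p :: real and a :: "real \<Rightarrow> real" and c d :: real
  assumes R: "0 < R" and p: "1 < p"
    and a_cont: "continuous_on {0..R} a" and a_pos: "\<And>x. x \<in> {0..R} \<Longrightarrow> 0 < a x"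
    and cd: "d = 1 \<or> d = 0 \<and> c = 1"
begin

text \<open>The equation in (P) is \<open>u'' = F lam x u\<close>. The factored form displays the
  quotient of \<open>F\<close> by \<open>s\<close>, whose growth in |s| drives the
  comparison.\<close>

definition F :: "real \<Rightarrow> real \<Rightarrow> real \<Rightarrow> real" where
  "F lam x s = (a x * \<bar>s\<bar> powr (p - 1) - lam) * s"

definition sub :: "real \<Rightarrow> real \<Rightarrow> (real \<Rightarrow> real) \<Rightarrow> bool" where
  "sub lam b u \<longleftrightarrow> (\<exists>u' u''. C2_derivs b u u' u'' \<and>
     (\<forall>x\<in>{0..b}. 0 \<le> u x \<and> F lam x (u x) \<le> u'' x) \<and> d * u' 0 = c * u 0)"

definition super :: "real \<Rightarrow> real \<Rightarrow> (real \<Rightarrow> real) \<Rightarrow> bool" where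
  "super lam b w \<longleftrightarrow> (\<exists>w' w''. C2_derivs b w w' w'' \<and>
     (\<forall>x\<in>{0..b}. 0 \<le> w x \<and> (0 < x \<longrightarrow> 0 < w x) \<and> w'' x \<le> F lam x (w x)) \<and> d * w' 0 \<le> c * w 0)"

definition sol :: "real \<Rightarrow> real \<Rightarrow> (real \<Rightarrow> real) \<Rightarrow> (real \<Rightarrow> real) \<Rightarrow> bool" where
  "sol lam b u v \<longleftrightarrow> C2_derivs b u v (\<lambda>x. F lam x (u x)) \<and> (\<forall>x\<in>{0..b}. 0 \<le> u x) \<and> d * v 0 = c * u 0"

lemma sol_imp_sub: "sol lam b u v \<Longrightarrow> sub lam b u"
  unfolding sol_def sub_def by (intro exI[of _ v] exI[of _ "\<lambda>x. F lam x (u x)"]) simp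

lemma sol_mono: "sol lam b u v \<Longrightarrow> b' \<le> b \<Longrightarrow> sol lam b' u v"
  unfolding sol_def using C2_derivs_mono[of b u v "\<lambda>x. F lam x (u x)" b'] by auto

lemma super_mono: 
  assumes "super lam b w" "b' \<le> b" shows "super lam b' w"
proof -
  from assms(1) obtain w' w'' where "C2_derivs b w w' w''"
    "\<forall>x\<in>{0..b}. 0 \<le> w x \<and> (0 < x \<longrightarrow> 0 < w x) \<and> w'' x \<le> F lam x (w x)" "d * w' 0 \<le> c * w 0"
    unfolding super_def by metis
  then show ?thesis using assms(2) C2_derivs_mono[of b w w' w'' b'] unfolding super_def
    by (intro exI[of _ w'] exI[of _ w'']) auto
qed

lemma a_bounds: "\<exists>m M. 0 < m \<and> (\<forall>x\<in>{0..R}. m \<le> a x \<and> a x \<le> M)"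
proof -
  obtain s where "s \<in> {0..R}" "\<forall>x\<in>{0..R}. a s \<le> a x"
    using continuous_attains_inf[of "{0..R}" a] a_cont R by auto
  moreover obtain t where "t \<in> {0..R}" "\<forall>x\<in>{0..R}. a x \<le> a t"
    using continuous_attains_sup[of "{0..R}" a] a_cont R by auto
  ultimately show ?thesis using a_pos by (intro exI[of _ "a s"] exI[of _ "a t"]) auto
qed

lemma F_continuous_on:
  assumes "continuous_on S u" "S \<subseteq> {0..R}"
  shows "continuous_on S (\<lambda>x. F lam x (u x))"
  unfolding F_def using p assms continuous_on_subset[OF a_cont assms(2)]
  by (intro continuous_intros continuous_on_powr') auto

lemma F_continuous:
  assumes "continuous_on {0..b} u" "b \<le> R"
  shows "continuous_on {0..b} (\<lambda>x. F lam x (u x))"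
  using assms by (intro F_continuous_on) auto

text \<open>In the Dirichlet case \<open>u 0 = 0\<close> and \<open>u \<ge> 0\<close> force
  \<open>u' 0 \<ge> 0\<close>. In the Robin case the Wronskian at 0 equals
  \<open>u 0 * (c * w 0 - w' 0)\<close>, which is nonnegative whatever the sign of
  \<open>c\<close>.\<close>

lemma sub_boundary_nonneg:
  assumes C: "C2_derivs b u u' u''" and u: "\<And>x. x \<in> {0..b} \<Longrightarrow> 0 \<le> u x" and "0 < b"
    and bc: "d * u' 0 = c * u 0" and w: "d * w' 0 \<le> c * w 0" "0 \<le> w 0"
  shows "u 0 * w' 0 \<le> u' 0 * w (0::real)"
proof (cases "d = 0")
  case True
  then have u0: "u 0 = 0" using cd bc by auto
  have "0 \<le> u' 0"
  proof (rule ccontr)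
    assume "\<not> 0 \<le> u' 0"
    moreover have "(u has_real_derivative u' 0) (at 0 within {0..b})"
      using C \<open>0 < b\<close> by (auto simp: C2_derivs_def)
    ultimately obtain e where e: "e > 0" "\<And>h. h > 0 \<Longrightarrow> 0 + h \<in> {0..b} \<Longrightarrow> h < e \<Longrightarrow> u (0 + h) < u 0"
      using has_real_derivative_neg_dec_right[of u "u' 0" 0 "{0..b}"] by force
    define h where "h = min (e/2) b"
    have "0 < h" "h < e" "h \<le> b" using e(1) \<open>0 < b\<close> by (auto simp: h_def)
    with e(2)[of h] u[of h] u0 show False by auto
  qed
  then show ?thesis using u0 w by simp
next
  case False
  then have "d = 1" using cd by auto
  then have "u' 0 * w 0 - u 0 * w' 0 = u 0 * (c * w 0 - w' 0)" using bc by (simp add: algebra_simps)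
  also have "\<dots> \<ge> 0" using w \<open>d = 1\<close> u[of 0] \<open>0 < b\<close> by simp
  finally show ?thesis by simp
qed

lemma sub_le_super:
  assumes "sub lam b u" "super lam b w" "0 < b" "b \<le> R" "u b \<le> w b" "x \<in> {0..b}"
  shows "u x \<le> w x"
proof -
  from \<open>sub lam b u\<close> obtain u' u'' where u: "C2_derivs b u u' u''"
    "\<And>x. x \<in> {0..b} \<Longrightarrow> 0 \<le> u x" "\<And>x. x \<in> {0..b} \<Longrightarrow> F lam x (u x) \<le> u'' x" "d * u' 0 = c * u 0"
    by (auto simp: sub_def)
  from \<open>super lam b w\<close> obtain w' w'' where w: "C2_derivs b w w' w''"
    "\<And>x. x \<in> {0..b} \<Longrightarrow> 0 \<le> w x" "\<And>x. x \<in> {0..b} \<Longrightarrow> 0 < x \<Longrightarrow> 0 < w x"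
    "\<And>x. x \<in> {0..b} \<Longrightarrow> w'' x \<le> F lam x (w x)" "d * w' 0 \<le> c * w 0"
    unfolding super_def by blast
  have bc: "u 0 * w' 0 \<le> u' 0 * w 0"
    using u w \<open>0 < b\<close> by (intro sub_boundary_nonneg[of b u u' u'']) auto
  have gap: "u x * w'' x < u'' x * w x" if x: "0 < x" "x < b" "w x < u x" for x
  proof -
    have w0: "0 < w x" using w(3)[of x] x by auto
    have "\<bar>w x\<bar> powr (p - 1) < \<bar>u x\<bar> powr (p - 1)"
      using x w0 p by (auto intro!: powr_less_mono2)
    then have "a x * \<bar>w x\<bar> powr (p - 1) - lam < a x * \<bar>u x\<bar> powr (p - 1) - lam"
      using a_pos[of x] x \<open>b \<le> R\<close> by simp
    then have "u x * w x * (a x * \<bar>w x\<bar> powr (p - 1) - lam) < u x * w x * (a x * \<bar>u x\<bar> powr (p - 1) - lam)"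
      using x w0 by (intro mult_strict_left_mono) auto
    then have "u x * F lam x (w x) < F lam x (u x) * w x"
      by (simp add: F_def algebra_simps)
    moreover have "u x * w'' x \<le> u x * F lam x (w x)"
      using w(4)[of x] u(2)[of x] x by (intro mult_left_mono) auto
    moreover have "F lam x (u x) * w x \<le> u'' x * w x"
      using u(3)[of x] x w0 by (intro mult_right_mono) auto
    ultimately show ?thesis by linarith
  qed
  show ?thesis
    by (rule wronskian_comparison[of b u u' u'' w w' w'', OF _ _ _ _ w(2) bc assms(5) gap assms(6)])
      (use u(1) w(1) in \<open>auto simp: C2_derivs_def\<close>)
qed

text \<open>An interior zero of a nonnegative solution is a minimum, so the slope vanishes there
  too, and \<open>|F lam x u| \<le> K * |u|\<close> on compact intervals carries the zero to the
  right end. Read backwards, a positive end value excludes interior zeros, which is what makes a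
  solution a supersolution.\<close>

lemma sol_zero_propagates:
  assumes S: "sol lam b u v" and "b \<le> R" "0 < s" "s < b" "u s = 0"
  shows "u b = 0"
proof -
  have C: "C2_derivs b u v (\<lambda>x. F lam x (u x))" and u0: "\<And>x. x \<in> {0..b} \<Longrightarrow> 0 \<le> u x"
    using S by (auto simp: sol_def)
  have "continuous_on {0..b} (\<lambda>x. a x * \<bar>u x\<bar> powr (p - 1) - lam)"
    using a_cont \<open>b \<le> R\<close> p C2_derivs_continuous(1)[OF C]
    by (intro continuous_intros continuous_on_powr') (auto intro: continuous_on_subset)
  then have "bounded ((\<lambda>x. a x * \<bar>u x\<bar> powr (p - 1) - lam) ` {0..b})"
    by (intro compact_imp_bounded compact_continuous_image) auto
  then obtain K where "\<forall>y\<in>(\<lambda>x. a x * \<bar>u x\<bar> powr (p - 1) - lam) ` {0..b}. norm y \<le> K"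
    unfolding bounded_iff ..
  then have K: "\<bar>a x * \<bar>u x\<bar> powr (p - 1) - lam\<bar> \<le> K" if "x \<in> {0..b}" for x
    using that by auto
  have "(u has_real_derivative v s) (at s)"
    using C assms at_within_interior[of s "{0..b}"] unfolding C2_derivs_def
    by (metis atLeastAtMost_iff greaterThanLessThan_iff interior_atLeastAtMost_real less_imp_le)
  then have vs: "v s = 0"
    by (rule DERIV_local_min[of u "v s" s "min s (b - s)"]) (use assms u0 in \<open>auto simp: abs_if split: if_splits\<close>)
  show ?thesis
  proof (rule gronwall_zero[where u = u and v = v and g = "\<lambda>x. F lam x (u x)" and s = s and K = K])
    fix x assume x: "x \<in> {s..b}"
    show "(u has_real_derivative v x) (at x within {s..b})"
      by (rule DERIV_subset[of _ _ _ "{0..b}"]) (use C x assms in \<open>auto simp: C2_derivs_def\<close>)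
    show "(v has_real_derivative F lam x (u x)) (at x within {s..b})"
      by (rule DERIV_subset[of _ _ _ "{0..b}"]) (use C x assms in \<open>auto simp: C2_derivs_def\<close>)
    show "\<bar>F lam x (u x)\<bar> \<le> K * \<bar>u x\<bar>"
      unfolding F_def abs_mult using K[of x] x assms by (intro mult_right_mono) auto
  qed (use assms vs in auto)
qed

lemma sol_imp_super:
  assumes "sol lam b u v" "b \<le> R" "0 < u b"
  shows "super lam b u"
proof -
  have "0 < u x" if "x \<in> {0..b}" "0 < x" for x
    using sol_zero_propagates[OF assms(1,2), of x] that assms
    by (cases "x = b") (fastforce simp: sol_def less_le)+
  then show ?thesis using assms(1) unfolding sol_def super_def
    by (intro exI[of _ v] exI[of _ "\<lambda>x. F lam x (u x)"]) auto
qed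

text \<open>The equation is demanded on compact pieces \<open>[0,b]\<close> only, since the end
  \<open>r\<close> is singular, and one \<open>v\<close> serves all \<open>b\<close>. The blow-up
  point \<open>r\<close> may lie before \<open>R\<close>; this is how majorants of all solutions on
  \<open>[0,R)\<close> arise.\<close>

definition large :: "real \<Rightarrow> real \<Rightarrow> (real \<Rightarrow> real) \<Rightarrow> (real \<Rightarrow> real) \<Rightarrow> bool" where
  "large lam r u v \<longleftrightarrow> (\<forall>b. 0 < b \<longrightarrow> b < r \<longrightarrow> sol lam b u v) \<and> filterlim u at_top (at_left r)"

lemma at_top_at_left_witness:
  fixes r :: real
  assumes "filterlim u at_top (at_left r)" "x < r"
  obtains b where "x < b" "b < r" "C \<le> (u b :: real)"
proof -
  have "\<forall>\<^sub>F y in at_left r. x < y \<and> y < r"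
    using assms(2) by (intro eventually_at_leftI[of x r]) auto
  moreover have "\<forall>\<^sub>F y in at_left r. C \<le> u y" using assms(1) by (auto simp: filterlim_at_top)
  ultimately have "\<forall>\<^sub>F y in at_left r. C \<le> u y \<and> x < y \<and> y < r" by eventually_elim auto
  from eventually_happens'[OF trivial_limit_at_left_real this]
  obtain b where "C \<le> u b" "x < b" "b < r" by blast
  then show thesis by (rule that[rotated -1])
qed

lemma large_imp_super:
  assumes "large lam r u v" "r \<le> R" "0 < b" "b < r"
  shows "super lam b u"
proof -
  obtain b' where b': "b < b'" "b' < r" "1 \<le> u b'"
    using at_top_at_left_witness[of u r b 1] assms by (auto simp: large_def)
  then have "super lam b' u"
    using assms by (intro sol_imp_super[of _ _ _ v]) (auto simp: large_def)
  then show ?thesis using b' by (auto intro: super_mono)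
qed

text \<open>Close to \<open>r\<close> the supersolution exceeds the bound \<open>C\<close>, which
  provides the end inequality needed for \<open>sub_le_super\<close> on some \<open>[0,b]\<close>
  containing \<open>x\<close>.\<close>

lemma sub_le_blowup_super:
  assumes u: "\<And>b. 0 < b \<Longrightarrow> b < r \<Longrightarrow> sub lam b u" and C: "\<And>x. x \<in> {0..<r} \<Longrightarrow> u x \<le> C"
    and w: "\<And>b. 0 < b \<Longrightarrow> b < r \<Longrightarrow> super lam b w" "filterlim w at_top (at_left r)"
    and "r \<le> R" and x: "x \<in> {0..<r}"
  shows "u x \<le> w x"
proof -
  obtain b where b: "x < b" "b < r" "C \<le> w b"
    using at_top_at_left_witness[OF w(2), of x C] x by auto
  have b0: "0 < b" "b \<le> R" "x \<in> {0..b}" using b x \<open>r \<le> R\<close> by auto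
  have "u b \<le> w b" using C[of b] b b0 by auto
  with sub_le_super[OF u[of b] w(1)[of b]] b0 b(2) show ?thesis by blast
qed

text \<open>The exponent \<open>g\<close> of the barrier balances \<open>w'' / w\<close>, of order
  \<open>(\<rho> - x)^(-2)\<close>, against \<open>w^(p-1)\<close>. One \<open>w\<close> serves
  every \<open>lam \<le> Lam\<close>, as (c) requires. For \<open>\<rho> = 2 * R\<close> the
  singularity lies outside \<open>[0,R]\<close>, leaving a finite supersolution on all of
  \<open>[0,R]\<close> above any prescribed \<open>M\<close>.\<close>

lemma exists_blowup_super:
  assumes "0 < \<rho>" "\<rho> \<le> 2 * R"
  shows "\<exists>w. (\<forall>lam b. lam \<le> Lam \<longrightarrow> 0 < b \<longrightarrow> b < \<rho> \<longrightarrow> b \<le> R \<longrightarrow> super lam b w) \<and>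
     filterlim w at_top (at_left \<rho>) \<and> (\<forall>x\<in>{0..<\<rho>}. M \<le> w x \<and> 0 < w x) \<and> continuous_on {0..<\<rho>} w"
proof -
  obtain m0 M0 where m0: "0 < m0" "\<forall>x\<in>{0..R}. m0 \<le> a x \<and> a x \<le> M0"
    using a_bounds by blast
  text \<open>The factor \<open>exp (- m * x)\<close> only serves to enforce the boundary inequality at \<open>0\<close>.\<close>
  define g where "g = 2 / (p - 1)"
  define m where "m = g / \<rho> + \<bar>c\<bar>"
  have g: "0 < g" "(p - 1) * g = 2" using p by (auto simp: g_def field_simps)
  have m: "0 \<le> m" "g / \<rho> - m \<le> c" using g \<open>0 < \<rho>\<close> by (auto simp: m_def)
  \<comment> \<open>With \<open>y = \<rho> - x \<le> 2 * R\<close>, \<open>T\<close> bounds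
    \<open>y^2 * (w'' / w + lam)\<close>, and \<open>Q\<close> is the size of
    \<open>exp ((p - 1) * n)\<close> at which the nonlinear term absorbs \<open>T\<close> on
    \<open>[0,R]\<close>.\<close>
  define T where "T = (g + 2 * m * R)\<^sup>2 + g + \<bar>Lam\<bar> * (2 * R)\<^sup>2"
  have T: "0 < T" unfolding T_def using g by (intro add_nonneg_pos add_pos_nonneg) auto
  define Q where "Q = T / (m0 * exp (- (p - 1) * m * R))"
  have Q: "0 < Q" using T m0 by (auto simp: Q_def)
  \<comment> \<open>The first entry makes the amplitude large enough for \<open>Q\<close>; the
    second keeps the exponent of \<open>w\<close> above |M|, hence \<open>w \<ge> M\<close> by
    \<open>exp t \<ge> 1 + t\<close>.\<close>
  define n where "n = max (ln Q / (p - 1)) (\<bar>M\<bar> + g * ln \<rho> + m * \<rho>)"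
  have n: "Q \<le> exp ((p - 1) * n)"
  proof -
    have "ln Q \<le> (p - 1) * n" using p by (simp add: n_def field_simps max_def) 
    then show ?thesis using Q by (metis exp_le_cancel_iff exp_ln)
  qed
  define w where "w x = exp (n - g * ln (\<rho> - x) - m * x)" for x
  define w' where "w' x = w x * (g / (\<rho> - x) - m)" for x
  define w'' where "w'' x = w x * ((g / (\<rho> - x) - m)\<^sup>2 + g / (\<rho> - x)\<^sup>2)" for x
  have dw: "(w has_real_derivative w' x) (at x within S)" if "x < \<rho>" for x S
    unfolding w_def w'_def using that
    by (auto intro!: derivative_eq_intros simp: field_simps)
  have dw': "(w' has_real_derivative w'' x) (at x within S)" if "x < \<rho>" for x S
  proof -
    have q: "((\<lambda>x. g / (\<rho> - x) - m) has_real_derivative g / (\<rho> - x)\<^sup>2) (at x within S)"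
      using that by (auto intro!: derivative_eq_intros simp: power2_eq_square)
    have "w'' x = w' x * (g / (\<rho> - x) - m) + g / (\<rho> - x)\<^sup>2 * w x"
      unfolding w'_def w''_def power2_eq_square[of "g / (\<rho> - x) - m"] by (simp only: distrib_left mult_ac)
    with DERIV_mult[OF dw[OF that] q] show ?thesis by (simp add: w'_def[abs_def])
  qed
  have wF: "w'' x \<le> F lam x (w x)" if "lam \<le> Lam" "0 \<le> x" "x \<le> R" "x < \<rho>" for lam x
  proof -
    let ?y = "\<rho> - x"
    have y: "0 < ?y" "?y \<le> 2 * R" using that assms by auto
    have pw: "\<bar>w x\<bar> powr (p - 1) = exp ((p - 1) * n) * exp (- (p - 1) * m * x) / ?y\<^sup>2"
    proof -
      have "\<bar>w x\<bar> powr (p - 1) = exp ((p - 1) * n - ((p - 1) * g) * ln ?y + (- (p - 1) * m * x))"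
        by (simp add: w_def powr_def algebra_simps)
      also have "\<dots> = exp ((p - 1) * n) * exp (- (p - 1) * m * x) / exp (2 * ln ?y)"
        by (simp add: g exp_add exp_diff)
      also have "exp (2 * ln ?y) = ?y\<^sup>2" using y(1) by (simp only: exp_double exp_ln)
      finally show ?thesis .
    qed
    have "(g - m * ?y)\<^sup>2 \<le> (g + 2 * m * R)\<^sup>2"
    proof -
      have "0 \<le> m * ?y" "m * ?y \<le> m * (2 * R)" using m y by (auto intro: mult_left_mono)
      then have "\<bar>g - m * ?y\<bar> \<le> \<bar>g + 2 * m * R\<bar>" using g by (auto simp: abs_if)
      then show ?thesis by (simp add: abs_le_square_iff)
    qed
    moreover have "lam * ?y\<^sup>2 \<le> \<bar>Lam\<bar> * (2 * R)\<^sup>2"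
      using that(1) y by (intro mult_mono power_mono) auto
    ultimately have 1: "(g - m * ?y)\<^sup>2 + g + lam * ?y\<^sup>2 \<le> T" by (simp add: T_def)
    have "T = m0 * (Q * exp (- (p - 1) * m * R))" using m0 by (simp add: Q_def)
    also have "\<dots> \<le> a x * (exp ((p - 1) * n) * exp (- (p - 1) * m * x))"
      using m0 that n p m Q a_pos[of x] by (intro mult_mono) (auto intro: mult_left_mono)
    also have "\<dots> = a x * \<bar>w x\<bar> powr (p - 1) * ?y\<^sup>2" using y by (simp add: pw)
    finally have 2: "(g - m * ?y)\<^sup>2 + g \<le> (a x * \<bar>w x\<bar> powr (p - 1) - lam) * ?y\<^sup>2"
      using 1 by (simp add: left_diff_distrib)
    have "g / ?y - m = (g - m * ?y) / ?y" using y by (simp add: diff_divide_distrib)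
    then have "(g / ?y - m)\<^sup>2 + g / ?y\<^sup>2 = ((g - m * ?y)\<^sup>2 + g) / ?y\<^sup>2"
      by (simp add: power_divide add_divide_distrib)
    also have "\<dots> \<le> a x * \<bar>w x\<bar> powr (p - 1) - lam" using 2 y by (simp add: divide_le_eq)
    finally have "w x * ((g / ?y - m)\<^sup>2 + g / ?y\<^sup>2) \<le> w x * (a x * \<bar>w x\<bar> powr (p - 1) - lam)"
      by (intro mult_left_mono) (auto simp: w_def)
    then show ?thesis by (simp add: w''_def F_def mult.commute)
  qed
  have bc: "d * w' 0 \<le> c * w 0"
  proof -
    have "w 0 * (g / \<rho> - m) \<le> w 0 * c" using m by (intro mult_left_mono) (auto simp: w_def)
    moreover have "0 \<le> w 0" by (simp add: w_def)
    ultimately show ?thesis using cd by (auto simp: w'_def mult.commute)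
  qed
  show ?thesis
  proof (intro exI[of _ w] conjI allI impI ballI)
    show "super lam b w" if "lam \<le> Lam" "0 < b" "b < \<rho>" "b \<le> R" for lam b
      unfolding super_def C2_derivs_def using that bc
      by (intro exI[of _ w'] exI[of _ w''] conjI ballI dw dw' wF) (auto simp: w_def)
    show "filterlim w at_top (at_left \<rho>)"
      unfolding w_def using g by real_asymp
    show "0 < w x" for x by (simp add: w_def)
    show "M \<le> w x" if x: "x \<in> {0..<\<rho>}" for x
    proof -
      have "ln (\<rho> - x) \<le> ln \<rho>" using x by simp
      then have "g * ln (\<rho> - x) \<le> g * ln \<rho>" using g by (intro mult_left_mono) auto
      moreover have "m * x \<le> m * \<rho>" using m x by (intro mult_left_mono) auto
      ultimately have "\<bar>M\<bar> \<le> n - g * ln (\<rho> - x) - m * x" unfolding n_def by linarith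
      also have "\<dots> \<le> w x" unfolding w_def using exp_ge_add_one_self[of "n - g * ln (\<rho> - x) - m * x"] by linarith
      finally show ?thesis by linarith
    qed
    show "continuous_on {0..<\<rho>} w" by (rule DERIV_continuous_on[of _ _ w']) (auto intro: dw)
  qed
qed

section \<open>The Green operator\<close>


text \<open>The solution of \<open>y'' = k^2 * y\<close> with \<open>y 0 = d * k\<close> and
  \<open>y' 0 = c * k\<close>, which therefore meets the boundary condition at 0.\<close>

definition psi :: "real \<Rightarrow> real \<Rightarrow> real" where
  "psi k x = d * k * cosh (k * x) + c * sinh (k * x)"

definition psi' :: "real \<Rightarrow> real \<Rightarrow> real" where
  "psi' k x = k * (d * k * sinh (k * x) + c * cosh (k * x))"

text \<open>Variation of constants for \<open>- y'' + k^2 * y = h\<close> with the boundary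
  condition at 0 and \<open>y r = M\<close>: \<open>psi k\<close> meets the left condition,
  \<open>sinh (k * (r - x))\<close> vanishes at \<open>r\<close>, and their Wronskian is
  \<open>k * psi k r\<close> up to sign.\<close>

definition green :: "real \<Rightarrow> real \<Rightarrow> real \<Rightarrow> (real \<Rightarrow> real) \<Rightarrow> real \<Rightarrow> real" where
  "green k r M h x =
     (M * psi k x + (sinh (k * (r - x)) * integral {0..x} (\<lambda>t. psi k t * h t) +
                     psi k x * integral {x..r} (\<lambda>t. sinh (k * (r - t)) * h t)) / k) / psi k r"

text \<open>The terms that come from differentiating the limits of integration cancel, so only the
  factors in front of the integrals are differentiated.\<close>

definition green' :: "real \<Rightarrow> real \<Rightarrow> real \<Rightarrow> (real \<Rightarrow> real) \<Rightarrow> real \<Rightarrow> real" where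
  "green' k r M h x =
     (M * psi' k x + (- k * cosh (k * (r - x)) * integral {0..x} (\<lambda>t. psi k t * h t) +
                     psi' k x * integral {x..r} (\<lambda>t. sinh (k * (r - t)) * h t)) / k) / psi k r"

lemma psi_deriv: "(psi k has_real_derivative psi' k x) (at x within S)"
  unfolding psi_def[abs_def] psi'_def
  by (rule derivative_eq_intros refl)+ (simp add: algebra_simps)

lemma psi'_deriv: "(psi' k has_real_derivative k\<^sup>2 * psi k x) (at x within S)"
  unfolding psi_def psi'_def[abs_def]
  by (rule derivative_eq_intros refl)+ (simp add: algebra_simps power2_eq_square)

text \<open>\<open>k * cosh\<close> dominates \<open>|c| * sinh\<close> as soon as
  \<open>k > |c|\<close>; this is how Robin coefficients of either sign are accommodated by a
  positive Green kernel.\<close>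

lemma psi_pos:
  assumes "\<bar>c\<bar> < k" "0 < x" shows "0 < psi k x"
proof -
  have k: "0 < k" using assms by linarith
  then have s: "0 < sinh (k * x)" using assms by simp
  from cd show ?thesis
  proof
    assume "d = 1"
    have "\<bar>c\<bar> * sinh (k * x) < k * sinh (k * x)" using s assms by simp
    also have "\<dots> \<le> k * cosh (k * x)" using k sinh_less_cosh_real[of "k * x"] by simp
    finally have "\<bar>c * sinh (k * x)\<bar> < k * cosh (k * x)" using s by (simp add: abs_mult)
    then show ?thesis unfolding psi_def using \<open>d = 1\<close> by simp
  next
    assume "d = 0 \<and> c = 1" then show ?thesis unfolding psi_def using s by simp
  qed
qed

lemma psi_nonneg:
  assumes "\<bar>c\<bar> < k" "0 \<le> x" shows "0 \<le> psi k x"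
proof (cases "x = 0")
  case True
  have "0 < k" using assms by linarith
  then show ?thesis using True cd by (auto simp: psi_def)
next
  case False then show ?thesis using psi_pos[of k x] assms by auto
qed

text \<open>The addition theorems for \<open>k * r = k * x + k * (r - x)\<close>. That this
  Wronskian is constant in \<open>x\<close> makes the inhomogeneity in \<open>green_derivs\<close>
  come out as exactly \<open>h\<close>.\<close>

lemma psi_wronskian:
  "psi' k x * sinh (k * (r - x)) + k * (psi k x * cosh (k * (r - x))) = k * psi k r"
proof -
  have "k * r = k * x + k * (r - x)" by (simp add: algebra_simps)
  then have "psi k r = d * k * cosh (k * x + k * (r - x)) + c * sinh (k * x + k * (r - x))"
    by (simp only: psi_def)
  then show ?thesis unfolding cosh_add sinh_add psi'_def psi_def[of k x]
    by (simp only:) (simp only: ring_distribs mult_ac add_ac)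
qed

context
  fixes k r M :: real and h :: "real \<Rightarrow> real"
  assumes k: "\<bar>c\<bar> < k" and r: "0 < r" and h: "continuous_on {0..r} h"
begin

lemma green_integrands_continuous:
  "continuous_on {0..r} (\<lambda>t. psi k t * h t)" "continuous_on {0..r} (\<lambda>t. sinh (k * (r - t)) * h t)"
  unfolding psi_def by (intro continuous_intros h)+

lemma green_derivs:
  "C2_derivs r (green k r M h) (green' k r M h) (\<lambda>x. k\<^sup>2 * green k r M h x - h x)"
  unfolding C2_derivs_def
proof (intro ballI conjI)
  fix x assume x: "x \<in> {0..r}"
  let ?I = "\<lambda>x. integral {0..x} (\<lambda>t. psi k t * h t)"
  let ?J = "\<lambda>x. integral {x..r} (\<lambda>t. sinh (k * (r - t)) * h t)"
  let ?s = "\<lambda>x. sinh (k * (r - x))"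
  let ?t = "\<lambda>x. - k * cosh (k * (r - x))"
  have kp: "0 < k" "0 < psi k r" using k psi_pos[OF k r] by auto
  have I: "(?I has_real_derivative psi k x * h x) (at x within {0..r})"
    by (rule integral_has_real_derivative[OF green_integrands_continuous(1) x])
  have J: "(?J has_real_derivative - (?s x * h x)) (at x within {0..r})"
    by (rule integral_has_real_derivative'[OF green_integrands_continuous(2) x])
  have s: "(?s has_real_derivative ?t x) (at x within {0..r})"
    by (rule derivative_eq_intros refl)+ simp
  have t: "(?t has_real_derivative k\<^sup>2 * ?s x) (at x within {0..r})"
    by (rule derivative_eq_intros refl)+ (simp add: power2_eq_square)
  show "(green k r M h has_real_derivative green' k r M h x) (at x within {0..r})"
    unfolding green_def[abs_def] green'_def
    by (rule DERIV_cdivide derivative_eq_intros s I J psi_deriv refl)+ (simp add: algebra_simps)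
  have "((\<lambda>x. (M * psi' k x + (?t x * ?I x + psi' k x * ?J x) / k) / psi k r) has_real_derivative
     (M * (k\<^sup>2 * psi k x) + ((k\<^sup>2 * ?s x * ?I x + psi k x * h x * ?t x) +
        (k\<^sup>2 * psi k x * ?J x + - (?s x * h x) * psi' k x)) / k) / psi k r) (at x within {0..r})"
    by (intro DERIV_cdivide DERIV_add DERIV_mult DERIV_cmult s t I J psi'_deriv)
  moreover have "(M * (k\<^sup>2 * psi k x) + ((k\<^sup>2 * ?s x * ?I x + psi k x * h x * ?t x) +
        (k\<^sup>2 * psi k x * ?J x + - (?s x * h x) * psi' k x)) / k) / psi k r
      = k\<^sup>2 * green k r M h x - (psi' k x * ?s x + k * (psi k x * cosh (k * (r - x)))) * h x / k / psi k r"
    unfolding green_def by (simp add: algebra_simps add_divide_distrib diff_divide_distrib)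
  moreover have "(psi' k x * ?s x + k * (psi k x * cosh (k * (r - x)))) * h x / k / psi k r = h x"
    unfolding psi_wronskian using kp by simp
  ultimately show "(green' k r M h has_real_derivative k\<^sup>2 * green k r M h x - h x) (at x within {0..r})"
    unfolding green'_def[abs_def] by simp
qed

lemma green_boundary: "d * green' k r M h 0 = c * green k r M h 0" "green k r M h r = M"
proof -
  have "d * psi' k 0 = c * psi k 0" by (simp add: psi_def psi'_def)
  then show "d * green' k r M h 0 = c * green k r M h 0"
    by (simp add: green_def green'_def algebra_simps add_divide_distrib) 
  show "green k r M h r = M" using psi_pos[OF k r] by (simp add: green_def)
qed

text \<open>The kernel is a product of nonnegative factors: \<open>psi k\<close> by
  \<open>psi_nonneg\<close>, and \<open>sinh (k * (r - x))\<close> for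
  \<open>x \<le> r\<close>.\<close>

lemma green_mono:
  assumes h': "continuous_on {0..r} h'" and le: "\<And>x. x \<in> {0..r} \<Longrightarrow> h x \<le> h' x" and x: "x \<in> {0..r}"
  shows "green k r M h x \<le> green k r M h' x"
proof -
  have kp: "0 < k" "0 < psi k r" using k psi_pos[OF k r] by auto
  have c': "continuous_on {0..r} (\<lambda>t. psi k t * h' t)" "continuous_on {0..r} (\<lambda>t. sinh (k * (r - t)) * h' t)"
    unfolding psi_def by (intro continuous_intros h')+
  note c = green_integrands_continuous c'
  have "integral {0..x} (\<lambda>t. psi k t * h t) \<le> integral {0..x} (\<lambda>t. psi k t * h' t)"
    using x by (intro integral_le integrable_continuous_interval continuous_on_subset[OF c(1)]
       continuous_on_subset[OF c(3)] mult_left_mono le psi_nonneg[OF k]) auto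
  moreover have "integral {x..r} (\<lambda>t. sinh (k * (r - t)) * h t) \<le> integral {x..r} (\<lambda>t. sinh (k * (r - t)) * h' t)"
    using x kp by (intro integral_le integrable_continuous_interval continuous_on_subset[OF c(2)]
       continuous_on_subset[OF c(4)] mult_left_mono le) auto
  ultimately show ?thesis
    unfolding green_def using kp x psi_nonneg[OF k, of x]
    by (intro divide_right_mono add_left_mono add_mono mult_left_mono) auto
qed

end

lemma green_nonneg:
  assumes k: "\<bar>c\<bar> < k" and r: "0 < r" and h: "continuous_on {0..r} h"
    and "\<And>x. x \<in> {0..r} \<Longrightarrow> 0 \<le> h x" and x: "x \<in> {0..r}" and "0 \<le> M"
  shows "0 \<le> green k r M h x"
proof -
  have "0 \<le> green k r M (\<lambda>_. 0) x"
    using psi_nonneg[OF k, of x] psi_pos[OF k r] x \<open>0 \<le> M\<close> by (simp add: green_def)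
  also have "\<dots> \<le> green k r M h x"
    by (rule green_mono[OF k r _ h]) (use assms in auto)
  finally show ?thesis .
qed

text \<open>\<open>u'' = F lam x u\<close> is the same as
  \<open>- u'' + k^2 * u = shifted k lam x u\<close>; for large \<open>k\<close> the right-hand side
  is increasing in \<open>u\<close> on a given range \<open>[0,C]\<close>, which the monotone
  iteration requires.\<close>

definition shifted :: "real \<Rightarrow> real \<Rightarrow> real \<Rightarrow> real \<Rightarrow> real" where
  "shifted k lam x s = k\<^sup>2 * s - F lam x s"

text \<open>The Lipschitz bound of the \<open>p\<close>-th power on \<open>[0,C]\<close>, by the
  mean value theorem; \<open>s = 0\<close> is estimated directly, so that the power is
  differentiated at positive arguments only.\<close>

lemma powr_increment_le:
  fixes s t C :: real
  assumes "0 \<le> s" "s \<le> t" "t \<le> C"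
  shows "t powr (p - 1) * t - s powr (p - 1) * s \<le> p * C powr (p - 1) * (t - s)"
proof (cases "s = t")
  case False
  then have st: "s < t" using assms by simp
  have le: "z powr (p - 1) \<le> C powr (p - 1)" if "0 \<le> z" "z \<le> C" for z
    using that p by (intro powr_mono2) auto
  show ?thesis
  proof (cases "s = 0")
    case True
    have "t powr (p - 1) * t \<le> C powr (p - 1) * t" using le assms by (intro mult_right_mono) auto
    also have "\<dots> \<le> p * (C powr (p - 1) * t)" using p assms by (intro mult_right_mono[of 1 p, simplified]) auto
    finally show ?thesis using True by (simp add: mult_ac)
  next
    case False
    then have s: "0 < s" using assms by simp
    have "\<exists>z>s. z < t \<and> t powr p - s powr p = (t - s) * (p * z powr (p - 1))"
      using st s by (intro MVT2) (auto intro!: derivative_eq_intros)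
    then obtain z where z: "s < z" "z < t" "t powr p - s powr p = (t - s) * (p * z powr (p - 1))" by blast
    have pw: "y powr (p - 1) * y = y powr p" if "0 < y" for y :: real
      using that powr_add[of y "p - 1" 1] by simp
    have "(t - s) * (p * z powr (p - 1)) \<le> (t - s) * (p * C powr (p - 1))"
      using z s st assms p by (intro mult_left_mono le) auto
    then show ?thesis using z pw[of s] pw[of t] s st by (simp add: mult_ac)
  qed
qed simp

context
  fixes k lam C :: real
  assumes C: "0 < C" and k: "\<And>x. x \<in> {0..R} \<Longrightarrow> a x * (p * C powr (p - 1)) < k\<^sup>2 + lam"
begin

lemma shifted_mono:
  assumes "x \<in> {0..R}" "0 \<le> s" "s \<le> t" "t \<le> C"
  shows "shifted k lam x s \<le> shifted k lam x t"
proof -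
  have "a x * (t powr (p - 1) * t - s powr (p - 1) * s) \<le> a x * (p * C powr (p - 1) * (t - s))"
    using powr_increment_le[of s t C] a_pos[of x] assms by (intro mult_left_mono) auto
  also have "\<dots> = a x * (p * C powr (p - 1)) * (t - s)" by simp
  also have "\<dots> \<le> (k\<^sup>2 + lam) * (t - s)" using k[of x] assms by (intro mult_right_mono) auto
  finally show ?thesis using assms by (simp add: shifted_def F_def algebra_simps)
qed

lemma shifted_nonneg: "x \<in> {0..R} \<Longrightarrow> 0 \<le> s \<Longrightarrow> s \<le> C \<Longrightarrow> 0 \<le> shifted k lam x s"
  using shifted_mono[of x 0 s] by (simp add: shifted_def F_def)

text \<open>The strictness here supplies the strict gap condition in
  \<open>green_shifted_le_super\<close>.\<close>

lemma shifted_pos: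
  assumes "x \<in> {0..R}" "0 < s" "s \<le> C" shows "0 < shifted k lam x s"
proof -
  have "a x * s powr (p - 1) \<le> a x * (p * C powr (p - 1))"
  proof (rule mult_left_mono)
    have "s powr (p - 1) \<le> 1 * C powr (p - 1)" using assms p by (simp add: powr_mono2)
    also have "\<dots> \<le> p * C powr (p - 1)" using p by (intro mult_right_mono) auto
    finally show "s powr (p - 1) \<le> p * C powr (p - 1)" .
  qed (use a_pos[of x] assms in auto)
  then have "0 < (k\<^sup>2 + lam - a x * s powr (p - 1)) * s"
    using k[of x] assms by (intro mult_pos_pos) auto
  then show ?thesis using assms by (simp add: shifted_def F_def algebra_simps)
qed

end

text \<open>With \<open>h\<close> the shifted right-hand side of \<open>w\<close>, the Green
  function satisfies \<open>u'' = k^2 * u - h\<close> and the supersolution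
  \<open>w'' \<le> k^2 * w - h\<close>. Hence \<open>u'' * w - u * w'' \<ge> h * (u - w)\<close>,
  positive where \<open>u > w > 0\<close>, and the Wronskian comparison applies to the linear
  problem as well. This is the first descent of the iteration.\<close>

lemma green_shifted_le_super:
  assumes k: "\<And>x. x \<in> {0..R} \<Longrightarrow> a x * (p * C powr (p - 1)) < k\<^sup>2 + lam" and kc: "\<bar>c\<bar> < k"
    and r: "0 < r" "r \<le> R" and w: "super lam r w" "0 \<le> M" "M \<le> w r"
    and C: "0 < C" "\<And>x. x \<in> {0..r} \<Longrightarrow> w x \<le> C"
    and x: "x \<in> {0..r}"
  shows "green k r M (\<lambda>x. shifted k lam x (w x)) x \<le> w x"
proof -
  from w(1) obtain w' w'' where W: "C2_derivs r w w' w''"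
    "\<And>x. x \<in> {0..r} \<Longrightarrow> 0 \<le> w x" "\<And>x. x \<in> {0..r} \<Longrightarrow> 0 < x \<Longrightarrow> 0 < w x"
    "\<And>x. x \<in> {0..r} \<Longrightarrow> w'' x \<le> F lam x (w x)" "d * w' 0 \<le> c * w 0"
    unfolding super_def by blast
  let ?h = "\<lambda>x. shifted k lam x (w x)"
  have hc: "continuous_on {0..r} ?h" unfolding shifted_def
    by (intro continuous_intros F_continuous r C2_derivs_continuous(1)[OF W(1)])
  let ?u = "green k r M ?h" and ?u' = "green' k r M ?h"
  let ?u'' = "\<lambda>x. k\<^sup>2 * ?u x - ?h x"
  have U: "C2_derivs r ?u ?u' ?u''" by (rule green_derivs[OF kc r(1) hc])
  have u0: "0 \<le> ?u x" if "x \<in> {0..r}" for x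
    using that W r C w by (intro green_nonneg[OF kc r(1) hc] shifted_nonneg[OF C(1) k]) auto
  have bc: "?u 0 * w' 0 \<le> ?u' 0 * w 0"
    by (rule sub_boundary_nonneg[where u = ?u and u' = ?u', OF U u0 r(1) green_boundary(1)[OF kc r(1) hc]])
      (use W r in auto)
  have gap: "?u x * w'' x < ?u'' x * w x" if x: "0 < x" "x < r" "w x < ?u x" for x
  proof -
    have xr: "x \<in> {0..r}" "x \<in> {0..R}" using x r by auto
    have hp: "0 < ?h x" using shifted_pos[OF C(1) k, of x "w x"] xr x W(3)[of x] C(2)[of x] by auto
    have "?u x * w'' x \<le> ?u x * F lam x (w x)" using W(4) u0 xr by (intro mult_left_mono) auto
    moreover have "?u x * F lam x (w x) = ?u x * (k\<^sup>2 * w x - ?h x)" by (simp add: shifted_def)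
    moreover have "?u'' x * w x - ?u x * (k\<^sup>2 * w x - ?h x) = ?h x * (?u x - w x)"
      by (simp only: left_diff_distrib right_diff_distrib mult_ac)
    moreover have "0 < ?h x * (?u x - w x)" using hp x by simp
    ultimately show ?thesis by linarith
  qed
  show ?thesis
    by (rule wronskian_comparison[of r ?u ?u' ?u'' w w' w'', OF _ _ _ _ W(2) bc _ gap x])
      (use U W(1) w green_boundary(2)[OF kc r(1) hc, of M] in \<open>auto simp: C2_derivs_def\<close>)
qed

section \<open>Existence with a finite end value\<close>


lemma exists_shift:
  assumes "0 < C"
  obtains k where "\<bar>c\<bar> < k" "\<And>x. x \<in> {0..R} \<Longrightarrow> a x * (p * C powr (p - 1)) < k\<^sup>2 + lam"
proof -
  obtain m M where M: "\<forall>x\<in>{0..R}. m \<le> a x \<and> a x \<le> M" using a_bounds by blast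
  define P where "P = p * C powr (p - 1)"
  have P: "0 \<le> P" using p by (simp add: P_def)
  \<comment> \<open>The summand 1 gives \<open>k > |c|\<close> and \<open>k \<ge> 1\<close>, hence
    \<open>k^2 \<ge> k > M * P - lam\<close>.\<close>
  define k where "k = \<bar>c\<bar> + \<bar>M * P - lam\<bar> + 1"
  have "M * P - lam < k\<^sup>2"
  proof -
    have "M * P - lam < k" by (simp add: k_def)
    also have "k \<le> k\<^sup>2" using self_le_power[of k 2] by (simp add: k_def)
    finally show ?thesis .
  qed
  moreover have "a x * P \<le> M * P" if "x \<in> {0..R}" for x
    using M that P by (intro mult_right_mono) auto
  ultimately have "a x * P < k\<^sup>2 + lam" if "x \<in> {0..R}" for x using that by force
  moreover have "\<bar>c\<bar> < k" by (simp add: k_def)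
  ultimately show thesis by (intro that[of k]) (simp_all add: P_def)
qed

lemma F_tendsto:
  assumes "(\<lambda>n. u n) \<longlonglongrightarrow> s" shows "(\<lambda>n. F lam x (u n)) \<longlonglongrightarrow> F lam x s"
proof -
  have pw: "(\<lambda>n. \<bar>u n\<bar> powr (p - 1)) \<longlonglongrightarrow> \<bar>s\<bar> powr (p - 1)"
    by (rule tendsto_powr2) (use assms p in \<open>auto intro: tendsto_rabs\<close>)
  show ?thesis unfolding F_def by (intro tendsto_mult tendsto_diff tendsto_const pw assms)
qed

lemma exists_sol_with_end_value:
  assumes r: "0 < r" "r \<le> R" and M: "0 < M"
  obtains u v where "sol lam r u v" "u r = M"
proof -
  \<comment> \<open>Singular only at \<open>2 * R\<close>, this barrier is finite on
    \<open>[0,r]\<close> and can serve as the initial iterate.\<close>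
  obtain w where w: "\<forall>lam' b. lam' \<le> lam \<longrightarrow> 0 < b \<longrightarrow> b < 2 * R \<longrightarrow> b \<le> R \<longrightarrow> super lam' b w"
    "\<forall>x\<in>{0..<2 * R}. M \<le> w x \<and> 0 < w x" "continuous_on {0..<2 * R} w"
    using exists_blowup_super[of "2 * R" lam M] R by auto
  have W: "super lam r w" using w(1) r R by simp
  have wc: "continuous_on {0..r} w" using r R by (intro continuous_on_subset[OF w(3)]) auto
  obtain t where t: "t \<in> {0..r}" "\<And>x. x \<in> {0..r} \<Longrightarrow> w x \<le> w t"
    using continuous_attains_sup[of "{0..r}" w] wc r by auto
  \<comment> \<open>All iterates stay in \<open>[0,C]\<close>, the range on which the shift
    \<open>k\<close> makes the right-hand side increasing.\<close>
  define C where "C = w t"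
  have C: "0 < C" "\<And>x. x \<in> {0..r} \<Longrightarrow> w x \<le> C" using t w(2) r R by (auto simp: C_def)
  obtain k where kc: "\<bar>c\<bar> < k" and k: "\<And>x. x \<in> {0..R} \<Longrightarrow> a x * (p * C powr (p - 1)) < k\<^sup>2 + lam"
    using exists_shift[OF C(1), of lam] by blast
  let ?h = "\<lambda>v x. shifted k lam x (v x)"
  define T where "T v = green k r M (?h v)" for v
  define U where "U n = (T ^^ n) w" for n
  have U_Suc: "U (Suc n) = T (U n)" for n by (simp add: U_def)
  have hc: "continuous_on {0..r} (?h v)" if "continuous_on {0..r} v" for v
    unfolding shifted_def by (intro continuous_intros F_continuous r that)
  have Tc: "continuous_on {0..r} (T v)" if "continuous_on {0..r} v" for v
    unfolding T_def by (rule C2_derivs_continuous(1)[OF green_derivs[OF kc r(1) hc[OF that]]])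
  have in_R: "x \<in> {0..R}" if "x \<in> {0..r}" for x using that r by auto
  have inv: "continuous_on {0..r} (U n) \<and> (\<forall>x\<in>{0..r}. 0 \<le> U n x \<and> U n x \<le> w x \<and> U (Suc n) x \<le> U n x)" for n
  proof (induction n)
    case 0
    have "T w x \<le> w x" if "x \<in> {0..r}" for x
      unfolding T_def by (rule green_shifted_le_super[OF k kc r W _ _ C that]) (use M w(2) r R in auto)
    then show ?case using wc w(2) r R by (auto simp: U_def less_imp_le)
  next
    case (Suc n)
    then have c0: "continuous_on {0..r} (U n)" and c1: "continuous_on {0..r} (U (Suc n))"
      by (auto simp: U_Suc intro: Tc)
    have nonneg: "0 \<le> U (Suc n) x" if x: "x \<in> {0..r}" for x
      unfolding U_Suc T_def
    proof (rule green_nonneg[OF kc r(1) hc[OF c0] _ x])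
      fix y assume y: "y \<in> {0..r}"
      then show "0 \<le> ?h (U n) y"
        using Suc C(2)[OF y] by (intro shifted_nonneg[OF C(1) k in_R]) force+
    qed (use M in simp)
    have "U (Suc (Suc n)) x \<le> U (Suc n) x" if x: "x \<in> {0..r}" for x
      unfolding U_Suc[of "Suc n"] U_Suc[of n] T_def
    proof (rule green_mono[OF kc r(1) _ hc[OF c0] _ x])
      show "continuous_on {0..r} (?h (green k r M (?h (U n))))"
        using hc[OF c1] by (simp add: U_Suc T_def)
      fix y assume y: "y \<in> {0..r}"
      have "?h (U (Suc n)) y \<le> ?h (U n) y"
        using Suc C(2)[OF y] y nonneg[OF y] by (intro shifted_mono[OF C(1) k in_R[OF y]]) force+
      then show "shifted k lam y (green k r M (?h (U n)) y) \<le> ?h (U n) y"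
        by (simp add: U_Suc T_def)
    qed
    moreover have "U (Suc n) x \<le> w x" if x: "x \<in> {0..r}" for x
      using Suc x by force
    ultimately show ?case using c1 nonneg by blast
  qed
  have Uc: "continuous_on {0..r} (U n)" for n using inv[of n] by blast
  have U0: "0 \<le> U n x" and UC: "U n x \<le> C" and Udec: "U (Suc n) x \<le> U n x" if "x \<in> {0..r}" for n x
    using inv[of n] C(2)[OF that] that by force+
  have "\<exists>L. (\<lambda>n. U n x) \<longlonglongrightarrow> L" if x: "x \<in> {0..r}" for x
  proof -
    have "decseq (\<lambda>n. U n x)" using Udec[OF x] by (simp add: decseq_Suc_iff)
    from decseq_convergent[OF this, of 0] U0[OF x] show ?thesis by blast
  qed
  then obtain V where V: "\<And>x. x \<in> {0..r} \<Longrightarrow> (\<lambda>n. U n x) \<longlonglongrightarrow> V x" by metis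
  \<comment> \<open>From \<open>U 1\<close> on the iterates are values of the Green operator and
    carry its boundary data, so the sequence passed to the limit starts there.\<close>
  define f where "f n = U (Suc n)" for n
  define f' where "f' n = green' k r M (?h (U n))" for n
  define g where "g n x = k\<^sup>2 * U (Suc n) x - ?h (U n) x" for n x
  have C2: "C2_derivs r (f n) (f' n) (g n)" for n
    using green_derivs[OF kc r(1) hc[OF Uc[of n]], of M]
    by (simp add: f_def f'_def g_def[abs_def] U_Suc T_def)
  have gC: "\<bar>g n x\<bar> \<le> k\<^sup>2 * C + (k\<^sup>2 + \<bar>lam\<bar>) * C" if x: "x \<in> {0..r}" for n x
  proof -
    have "0 \<le> ?h (U n) x" using U0[OF x] UC[OF x] by (intro shifted_nonneg[OF C(1) k in_R[OF x]])
    moreover have "?h (U n) x \<le> (k\<^sup>2 + \<bar>lam\<bar>) * C"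
    proof -
      have "0 \<le> a x * \<bar>U n x\<bar> powr (p - 1) * U n x" using a_pos[OF in_R[OF x]] U0[OF x, of n] by simp
      then have "?h (U n) x \<le> (k\<^sup>2 + lam) * U n x" by (simp add: shifted_def F_def algebra_simps)
      also have "\<dots> \<le> (k\<^sup>2 + \<bar>lam\<bar>) * C" using U0[OF x] UC[OF x] by (intro mult_mono) auto
      finally show ?thesis .
    qed
    moreover have "0 \<le> k\<^sup>2 * U (Suc n) x" "k\<^sup>2 * U (Suc n) x \<le> k\<^sup>2 * C"
      using U0[OF x] UC[OF x] by (auto intro: mult_left_mono)
    ultimately show ?thesis unfolding g_def by linarith
  qed
  have flim: "(\<lambda>n. f n x) \<longlonglongrightarrow> V x" if "x \<in> {0..r}" for x
    unfolding f_def using V[OF that] by (rule LIMSEQ_Suc)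
  \<comment> \<open>The linear terms of the new and the old iterate cancel in the limit, which
    leaves the original nonlinearity.\<close>
  have glim: "(\<lambda>n. g n x) \<longlonglongrightarrow> F lam x (V x)" if "x \<in> {0..r}" for x
  proof -
    have "(\<lambda>n. k\<^sup>2 * U (Suc n) x - (k\<^sup>2 * U n x - F lam x (U n x))) \<longlonglongrightarrow> k\<^sup>2 * V x - (k\<^sup>2 * V x - F lam x (V x))"
      by (intro tendsto_intros F_tendsto V[OF that] LIMSEQ_Suc)
    then show ?thesis by (simp add: g_def shifted_def)
  qed
  have fd: "(f n has_real_derivative f' n x) (at x within {0..r})"
    and fd': "(f' n has_real_derivative g n x) (at x within {0..r})" if "x \<in> {0..r}" for n x
    using C2[of n] that by (auto simp: C2_derivs_def)
  from second_derivative_limit[OF r(1) fd fd' gC flim glim] obtain D where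
    "\<forall>x\<in>{0..r}. (\<lambda>n. f' n x) \<longlonglongrightarrow> D x \<and> (V has_real_derivative D x) (at x within {0..r}) \<and>
      (continuous_on {0..r} (\<lambda>x. F lam x (V x)) \<longrightarrow> (D has_real_derivative F lam x (V x)) (at x within {0..r}))" ..
  then have D: "\<And>x. x \<in> {0..r} \<Longrightarrow> (\<lambda>n. f' n x) \<longlonglongrightarrow> D x"
    "\<And>x. x \<in> {0..r} \<Longrightarrow> (V has_real_derivative D x) (at x within {0..r})"
    "\<And>x. continuous_on {0..r} (\<lambda>x. F lam x (V x)) \<Longrightarrow> x \<in> {0..r} \<Longrightarrow>
        (D has_real_derivative F lam x (V x)) (at x within {0..r})"
    by simp_all
  have Vc: "continuous_on {0..r} V" by (rule DERIV_continuous_on[OF D(2)])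
  have "C2_derivs r V D (\<lambda>x. F lam x (V x))"
    unfolding C2_derivs_def using D(2) D(3)[OF F_continuous[OF Vc r(2)]] by blast
  moreover have "0 \<le> V x" if "x \<in> {0..r}" for x
    by (rule LIMSEQ_le_const[OF V[OF that]]) (use U0[OF that] in auto)
  moreover have "d * D 0 = c * V 0"
  proof -
    have "(\<lambda>n. d * f' n 0) \<longlonglongrightarrow> d * D 0" using r by (intro tendsto_intros D(1)) auto
    moreover have "(\<lambda>n. c * f n 0) \<longlonglongrightarrow> c * V 0" using r by (intro tendsto_intros flim) auto
    moreover have "d * f' n 0 = c * f n 0" for n
      using green_boundary(1)[OF kc r(1) hc[OF Uc[of n]]] by (simp add: f_def f'_def U_Suc T_def)
    ultimately show ?thesis using LIMSEQ_unique by simp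
  qed
  moreover have "V r = M"
  proof -
    have "f n r = M" for n
      using green_boundary(2)[OF kc r(1) hc[OF Uc[of n]]] by (simp add: f_def U_Suc T_def)
    with flim[of r] r show ?thesis by (simp add: LIMSEQ_const_iff)
  qed
  ultimately show thesis by (intro that[of V D]) (auto simp: sol_def)
qed

text \<open>The derivative of the limit is named \<open>lim (\<lambda>n. v n x)\<close>,
  independently of \<open>b\<close>, so that the results for different \<open>b\<close> fit together
  into one \<open>large\<close> function. The threshold \<open>N\<close> allows solutions that reach
  as far as \<open>b\<close> only from some index on.\<close>

lemma sol_limit:
  assumes S: "\<And>n. N \<le> n \<Longrightarrow> sol lam b (u n) (v n)" and b: "0 < b" "b \<le> R"
    and C: "\<And>n x. N \<le> n \<Longrightarrow> x \<in> {0..b} \<Longrightarrow> u n x \<le> C"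
    and lim: "\<And>x. x \<in> {0..b} \<Longrightarrow> (\<lambda>n. u n x) \<longlonglongrightarrow> U x"
  shows "sol lam b U (\<lambda>x. lim (\<lambda>n. v n x))"
proof -
  obtain m A where A: "0 < m" "\<forall>x\<in>{0..R}. m \<le> a x \<and> a x \<le> A" using a_bounds by blast
  have S': "sol lam b (u (n + N)) (v (n + N))" for n by (rule S) simp
  have d1: "(u (n + N) has_real_derivative v (n + N) x) (at x within {0..b})"
    and d2: "(v (n + N) has_real_derivative F lam x (u (n + N) x)) (at x within {0..b})"
    and pos: "0 \<le> u (n + N) x" if "x \<in> {0..b}" for n x
    using S'[of n] that by (auto simp: sol_def C2_derivs_def)
  have bound: "\<bar>F lam x (u (n + N) x)\<bar> \<le> (A * C powr (p - 1) + \<bar>lam\<bar>) * C" if x: "x \<in> {0..b}" for n x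
  proof -
    have u: "0 \<le> u (n + N) x" "u (n + N) x \<le> C" using pos[OF x] C[OF _ x] by auto
    have a: "0 < a x" "a x \<le> A" using a_pos[of x] A(2) x b by auto
    have "\<bar>a x * \<bar>u (n + N) x\<bar> powr (p - 1) - lam\<bar> \<le> a x * \<bar>u (n + N) x\<bar> powr (p - 1) + \<bar>lam\<bar>"
      using abs_triangle_ineq4[of "a x * \<bar>u (n + N) x\<bar> powr (p - 1)" lam] a by (simp add: abs_mult)
    also have "\<dots> \<le> A * C powr (p - 1) + \<bar>lam\<bar>"
      using u a p by (intro add_right_mono mult_mono powr_mono2) auto
    finally show ?thesis unfolding F_def abs_mult using u a by (intro mult_mono) (auto intro!: add_nonneg_nonneg)
  qed
  have lim': "(\<lambda>n. u (n + N) x) \<longlonglongrightarrow> U x" if "x \<in> {0..b}" for x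
    using lim[OF that] by (rule LIMSEQ_ignore_initial_segment)
  have Flim: "(\<lambda>n. F lam x (u (n + N) x)) \<longlonglongrightarrow> F lam x (U x)" if "x \<in> {0..b}" for x
    by (rule F_tendsto[OF lim'[OF that]])
  from second_derivative_limit[OF b(1) d1 d2 bound lim' Flim] obtain D where
    "\<forall>x\<in>{0..b}. (\<lambda>n. v (n + N) x) \<longlonglongrightarrow> D x \<and> (U has_real_derivative D x) (at x within {0..b}) \<and>
      (continuous_on {0..b} (\<lambda>x. F lam x (U x)) \<longrightarrow> (D has_real_derivative F lam x (U x)) (at x within {0..b}))" ..
  then have D: "\<And>x. x \<in> {0..b} \<Longrightarrow> (\<lambda>n. v (n + N) x) \<longlonglongrightarrow> D x"
    "\<And>x. x \<in> {0..b} \<Longrightarrow> (U has_real_derivative D x) (at x within {0..b})"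
    "\<And>x. continuous_on {0..b} (\<lambda>x. F lam x (U x)) \<Longrightarrow> x \<in> {0..b} \<Longrightarrow>
        (D has_real_derivative F lam x (U x)) (at x within {0..b})"
    by simp_all
  let ?V = "\<lambda>x. lim (\<lambda>n. v n x)"
  have DV: "?V x = D x" if "x \<in> {0..b}" for x
    by (rule limI[OF LIMSEQ_offset[OF D(1)[OF that]]])
  have Uc: "continuous_on {0..b} U" by (rule DERIV_continuous_on[OF D(2)])
  have "C2_derivs b U ?V (\<lambda>x. F lam x (U x))"
    unfolding C2_derivs_def
  proof (intro ballI conjI)
    fix x assume x: "x \<in> {0..b}"
    show "(U has_real_derivative ?V x) (at x within {0..b})" using D(2)[OF x] DV[OF x] by simp
    show "(?V has_real_derivative F lam x (U x)) (at x within {0..b})"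
      using D(3)[OF F_continuous[OF Uc b(2)] x]
      by (rule has_field_derivative_transform_within[OF _ zero_less_one x]) (simp add: DV)
  qed
  moreover have "0 \<le> U x" if "x \<in> {0..b}" for x
    by (rule LIMSEQ_le_const[OF lim'[OF that]]) (use pos[OF that] in auto)
  moreover have "d * ?V 0 = c * U 0"
  proof -
    have "(\<lambda>n. d * v (n + N) 0) \<longlonglongrightarrow> d * D 0" using b by (intro tendsto_intros D(1)) auto
    moreover have "(\<lambda>n. c * u (n + N) 0) \<longlonglongrightarrow> c * U 0" using b by (intro tendsto_intros lim') auto
    moreover have "d * v (n + N) 0 = c * u (n + N) 0" for n using S'[of n] by (simp add: sol_def)
    ultimately have "d * D 0 = c * U 0" using LIMSEQ_unique by simp
    then show ?thesis using DV[of 0] b by simp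
  qed
  ultimately show ?thesis by (auto simp: sol_def)
qed

section \<open>Blow-up solutions and their parameter dependence\<close>


lemma sol_bounded:
  assumes "sol lam b u v" shows "\<exists>C. \<forall>x\<in>{0..b}. u x \<le> C"
proof (cases "0 \<le> b")
  case True
  have "continuous_on {0..b} u" using assms C2_derivs_continuous(1) unfolding sol_def by blast
  then show ?thesis using continuous_attains_sup[of "{0..b}" u] True by force
qed auto

text \<open>The solutions with end values \<open>n + 1\<close> increase with \<open>n\<close>, and
  each, being bounded, lies below every supersolution that blows up at \<open>r\<close>. Minimality
  is therefore obtained against supersolutions, which include the other blow-up solutions.\<close>

lemma exists_minimal_large:
  assumes r: "0 < r" "r \<le> R"
  shows "\<exists>u v. large lam r u v \<and> (\<forall>w. (\<forall>b. 0 < b \<longrightarrow> b < r \<longrightarrow> super lam b w) \<longrightarrow>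
           filterlim w at_top (at_left r) \<longrightarrow> (\<forall>x\<in>{0..<r}. u x \<le> w x))"
proof -
  have "\<exists>u v. sol lam r u v \<and> u r = real (Suc n)" for n
    by (rule exists_sol_with_end_value[OF r, of "real (Suc n)" lam]) auto
  then obtain u v where uv: "\<And>n. sol lam r (u n) (v n)" "\<And>n. u n r = real (Suc n)" by metis
  have sub: "sub lam b (u n)" if "b \<le> r" for n b
    using sol_imp_sub[OF sol_mono[OF uv(1) that]] .
  have super: "super lam r (u n)" for n
    by (rule sol_imp_super[OF uv(1) r(2)]) (simp add: uv)
  have mono: "u n x \<le> u (Suc n) x" if "x \<in> {0..<r}" for n x
    using sub_le_super[OF sub super r, of n "Suc n" x] that by (simp add: uv(2))
  have le: "u n x \<le> w x" if "\<forall>b. 0 < b \<longrightarrow> b < r \<longrightarrow> super lam b w"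
    "filterlim w at_top (at_left r)" "x \<in> {0..<r}" for w n x
  proof -
    obtain C where C: "\<forall>x\<in>{0..r}. u n x \<le> C" using sol_bounded[OF uv(1)] by blast
    show ?thesis
      by (rule sub_le_blowup_super[of r lam "u n" C w, OF sub _ _ that(2) r(2) that(3)])
        (use C that(1) in auto)
  qed
  \<comment> \<open>One concrete barrier makes the increasing sequence converge, with bounds on each
    \<open>[0,b]\<close>.\<close>
  obtain W where W: "\<forall>lam' b. lam' \<le> lam \<longrightarrow> 0 < b \<longrightarrow> b < r \<longrightarrow> b \<le> R \<longrightarrow> super lam' b W"
    "filterlim W at_top (at_left r)" "continuous_on {0..<r} W"
    using exists_blowup_super[of r lam 0] r R by auto
  have leW: "u n x \<le> W x" if "x \<in> {0..<r}" for n x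
    by (rule le[OF _ W(2) that]) (use W(1) r in auto)
  have "\<exists>L. (\<lambda>n. u n x) \<longlonglongrightarrow> L \<and> (\<forall>n. u n x \<le> L)" if x: "x \<in> {0..<r}" for x
  proof -
    have "incseq (\<lambda>n. u n x)" using mono[OF x] by (simp add: incseq_Suc_iff)
    from incseq_convergent[OF this, of "W x"] leW[OF x] show ?thesis by blast
  qed
  then obtain U where U: "\<And>x. x \<in> {0..<r} \<Longrightarrow> (\<lambda>n. u n x) \<longlonglongrightarrow> U x"
    "\<And>n x. x \<in> {0..<r} \<Longrightarrow> u n x \<le> U x" by metis
  let ?V = "\<lambda>x. lim (\<lambda>n. v n x)"
  have "sol lam b U ?V" if b: "0 < b" "b < r" for b
  proof -
    have "continuous_on {0..b} W" using b by (intro continuous_on_subset[OF W(3)]) auto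
    then obtain t where t: "t \<in> {0..b}" "\<forall>x\<in>{0..b}. W x \<le> W t"
      using continuous_attains_sup[of "{0..b}" W] b by force
    show ?thesis
    proof (rule sol_limit[where N = 0 and u = u and C = "W t"])
      show "sol lam b (u n) (v n)" for n using sol_mono[OF uv(1)] b by simp
      show "u n x \<le> W t" if "x \<in> {0..b}" for n x
        using leW[of x n] t(2) that b by force
      show "(\<lambda>n. u n x) \<longlonglongrightarrow> U x" if "x \<in> {0..b}" for x
        using that b by (intro U(1)) auto
    qed (use b r in auto)
  qed
  \<comment> \<open>\<open>U\<close> lies above every \<open>u n\<close>, which is continuous at
    \<open>r\<close> with value \<open>n + 1\<close>.\<close>
  moreover have "filterlim U at_top (at_left r)"
    unfolding filterlim_at_top
  proof
    fix Z :: real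
    obtain n :: nat where "Z < real n" using reals_Archimedean2 by blast
    then have n: "Z < real (Suc n)" by linarith
    have "continuous_on {0..r} (u n)"
      using uv(1)[of n] C2_derivs_continuous(1) unfolding sol_def by blast
    then have "(u n \<longlongrightarrow> u n r) (at_left r)"
      using r by (auto simp: continuous_on_def at_within_Icc_at_left dest!: bspec[of _ _ r])
    then have "\<forall>\<^sub>F x in at_left r. Z < u n x"
      by (rule order_tendstoD) (use n uv(2)[of n] in simp)
    moreover have "\<forall>\<^sub>F x in at_left r. 0 < x \<and> x < r"
      using r by (intro eventually_at_leftI[of 0]) auto
    ultimately show "\<forall>\<^sub>F x in at_left r. Z \<le> U x"
    proof eventually_elim
      case (elim x)
      then show ?case using U(2)[of x n] by simp
    qed
  qed
  moreover have "U x \<le> w x" if "\<forall>b. 0 < b \<longrightarrow> b < r \<longrightarrow> super lam b w"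
    "filterlim w at_top (at_left r)" "x \<in> {0..<r}" for w x
    by (rule LIMSEQ_le_const2[OF U(1)[OF that(3)]]) (use le[OF that] in auto)
  ultimately show ?thesis unfolding large_def by blast
qed

text \<open>The function that blows up later is bounded on \<open>[0,r]\<close>, hence comparable
  with the one that blows up at \<open>r\<close>.\<close>

lemma large_le_large:
  assumes L: "large lam r' L V" and B: "large lam r B W" and "0 < r" "r < r'" "r' \<le> R" "x \<in> {0..<r}"
  shows "L x \<le> B x"
proof -
  have S: "sol lam b L V" if "0 < b" "b \<le> r" for b using L that assms by (auto simp: large_def)
  obtain C where C: "\<forall>x\<in>{0..r}. L x \<le> C" using sol_bounded[OF S[of r]] assms by blast
  show ?thesis
  proof (rule sub_le_blowup_super[of r lam L C B])
    show "sub lam b L" if "0 < b" "b < r" for b using sol_imp_sub[OF S] that by auto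
    show "super lam b B" if "0 < b" "b < r" for b
      by (rule large_imp_super[OF B _ that]) (use assms in auto)
  qed (use C assms in \<open>auto simp: large_def\<close>)
qed

lemma exists_maximal_large:
  "\<exists>u v. large lam R u v \<and> (\<forall>L V. large lam R L V \<longrightarrow> (\<forall>x\<in>{0..<R}. L x \<le> u x))"
proof -
  \<comment> \<open>The offset 2 keeps \<open>r 0 = R / 2\<close> positive.\<close>
  define r where "r n = R - R / real (n + 2)" for n
  have r: "0 < r n" "r n < R" for n using R by (auto simp: r_def field_simps intro!: add_pos_nonneg)
  have r_mono: "r n < r m" if "n < m" for n m
    using R that by (auto simp: r_def intro!: divide_strict_left_mono)
  have r_lim: "r \<longlonglongrightarrow> R" unfolding r_def by real_asymp
  have r_ev: "\<exists>N. \<forall>n\<ge>N. x < r n" if "x < R" for x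
    using order_tendstoD(1)[OF r_lim that] by (simp add: eventually_sequentially)
  have "\<exists>u v. large lam (r n) u v" for n
    using exists_minimal_large[of "r n" lam] r[of n] by auto
  then obtain B W where B: "\<And>n. large lam (r n) (B n) (W n)" by metis
  have anti: "B m x \<le> B n x" if "n \<le> m" "x \<in> {0..<r n}" for n m x
  proof (cases "n = m")
    case False
    then show ?thesis
      using that r[of n] r[of m] r_mono[of n m]
      by (intro large_le_large[OF B B, of n m]) auto
  qed simp
  have Bsol: "sol lam b (B n) (W n)" if "0 < b" "b < r n" for b n
    using B[of n] that by (auto simp: large_def)
  have B0: "0 \<le> B n x" if "0 \<le> x" "x < r n" for n x
  proof -
    have "sol lam ((x + r n) / 2) (B n) (W n)" using that r[of n] by (intro Bsol) auto
    then show ?thesis using that by (auto simp: sol_def)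
  qed
  have "\<exists>L. (\<lambda>n. B n x) \<longlonglongrightarrow> L" if x: "x \<in> {0..<R}" for x
  proof -
    \<comment> \<open>\<open>B n\<close> carries information at \<open>x\<close> only once
      \<open>x < r n\<close>, so the monotone sequence begins at \<open>N\<close>.\<close>
    obtain N where N: "\<forall>n\<ge>N. x < r n" using r_ev x by auto
    have "decseq (\<lambda>n. B (n + N) x)"
      using N x by (auto simp: decseq_Suc_iff intro!: anti)
    moreover have "\<forall>n. 0 \<le> B (n + N) x" using B0 x N by auto
    ultimately obtain L where "(\<lambda>n. B (n + N) x) \<longlonglongrightarrow> L" by (rule decseq_convergent) blast
    then have "(\<lambda>n. B n x) \<longlonglongrightarrow> L" by (rule LIMSEQ_offset)
    then show ?thesis ..
  qed
  then obtain U where U: "\<And>x. x \<in> {0..<R} \<Longrightarrow> (\<lambda>n. B n x) \<longlonglongrightarrow> U x" by metis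
  let ?V = "\<lambda>x. lim (\<lambda>n. W n x)"
  have S: "sol lam b U ?V" if b: "0 < b" "b < R" for b
  proof -
    obtain N where N: "\<forall>n\<ge>N. b < r n" using r_ev b by auto
    obtain C where C: "\<forall>x\<in>{0..b}. B N x \<le> C" using sol_bounded[OF Bsol[of b N]] b N by blast
    show ?thesis
    proof (rule sol_limit[where N = N and u = B and C = C])
      show "sol lam b (B n) (W n)" if "N \<le> n" for n using Bsol b N that by blast
      show "B n x \<le> C" if "N \<le> n" "x \<in> {0..b}" for n x
        using anti[of N n x] C N that by force
      show "(\<lambda>n. B n x) \<longlonglongrightarrow> U x" if "x \<in> {0..b}" for x
        using that b by (intro U) auto
    qed (use b in auto)
  qed
  have max: "L x \<le> U x" if L: "large lam R L V" and x: "x \<in> {0..<R}" for L V x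
  proof -
    obtain N where N: "\<forall>n\<ge>N. x < r n" using r_ev x by auto
    have "L x \<le> B n x" if "n \<ge> N" for n
      using x N that r[of n] by (intro large_le_large[OF L B, of n]) auto
    then show ?thesis using LIMSEQ_le_const[OF U[OF x]] by blast
  qed
  \<comment> \<open>A decreasing limit might lose the blow-up at \<open>R\<close>; a solution
    already known to exist lies below it and preserves it.\<close>
  obtain L V where L: "large lam R L V" using exists_minimal_large[of R lam] R by auto
  have "\<forall>\<^sub>F x in at_left R. L x \<le> U x"
    using R max[OF L] by (intro eventually_at_leftI[of 0]) auto
  then have "filterlim U at_top (at_left R)"
    using L by (auto simp: large_def intro: filterlim_at_top_mono)
  then have "large lam R U ?V" using S by (auto simp: large_def)
  then show ?thesis using max by blast
qed

section \<open>Limits for large positive and large negative \<open>lam\<close>\<close>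

lemma large_lower_bound:
  assumes "d = 1"
  shows "\<exists>\<Lambda>. \<forall>lam\<ge>\<Lambda>. \<forall>L V. large lam R L V \<longrightarrow> (\<forall>x\<in>{0..<R}. M \<le> L x)"
proof -
  obtain m A where A: "0 < m" "\<forall>x\<in>{0..R}. m \<le> a x \<and> a x \<le> A" using a_bounds by blast
  \<comment> \<open>\<open>N\<close> offsets the smallest possible value
    \<open>exp (- |c| * R)\<close> of the exponential, so that \<open>v \<ge> |M|\<close> on
    \<open>[0,R]\<close>; \<open>Z\<close> bounds \<open>v\<close> from above. As
    \<open>v' = c * v\<close>, the Robin condition holds exactly.\<close>
  define N where "N = \<bar>M\<bar> * exp (\<bar>c\<bar> * R)"
  define Z where "Z = N * exp (\<bar>c\<bar> * R)"
  define v where "v x = N * exp (c * x)" for x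
  have cx: "\<bar>c * x\<bar> \<le> \<bar>c\<bar> * R" if "x \<in> {0..R}" for x
    using that by (auto simp: abs_mult intro!: mult_left_mono)
  have vM: "M \<le> v x" and v0: "0 \<le> v x" and vZ: "v x \<le> Z" if x: "x \<in> {0..R}" for x
  proof -
    have "exp 0 \<le> exp (\<bar>c\<bar> * R + c * x)" using cx[OF x] by (intro iffD2[OF exp_le_cancel_iff]) linarith
    then have "\<bar>M\<bar> * 1 \<le> \<bar>M\<bar> * exp (\<bar>c\<bar> * R + c * x)" by (intro mult_left_mono) auto
    then show "M \<le> v x" unfolding v_def N_def exp_add by (simp add: mult.assoc)
    show "0 \<le> v x" by (simp add: v_def N_def)
    show "v x \<le> Z" unfolding v_def Z_def using cx[OF x] by (intro mult_left_mono) (auto simp: N_def)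
  qed
  have "M \<le> L x" if lam: "A * Z powr (p - 1) \<le> lam" and L: "large lam R L V" and x: "x \<in> {0..<R}" for lam L V x
  proof -
    have "v x \<le> L x"
    proof (rule sub_le_blowup_super[of R lam v Z L])
      fix b assume b: "0 < b" "b < R"
      have "F lam x (v x) \<le> c\<^sup>2 * v x" if "x \<in> {0..b}" for x
      proof -
        have xR: "x \<in> {0..R}" using that b by auto
        have "a x * \<bar>v x\<bar> powr (p - 1) \<le> A * Z powr (p - 1)"
          using A xR a_pos[OF xR] v0[OF xR] vZ[OF xR] p by (intro mult_mono powr_mono2) auto
        then have "F lam x (v x) \<le> 0" unfolding F_def using lam v0[OF xR]
          by (intro mult_nonpos_nonneg) auto
        also have "0 \<le> c\<^sup>2 * v x" using v0[OF xR] by simp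
        finally show ?thesis .
      qed
      moreover have "C2_derivs b v (\<lambda>x. c * v x) (\<lambda>x. c\<^sup>2 * v x)"
        unfolding C2_derivs_def v_def
        by (auto intro!: derivative_eq_intros simp: power2_eq_square)
      ultimately show "sub lam b v" unfolding sub_def using v0 b \<open>d = 1\<close>
        by (intro exI[of _ "\<lambda>x. c * v x"] exI[of _ "\<lambda>x. c\<^sup>2 * v x"]) auto
      show "super lam b L" by (rule large_imp_super[OF L order_refl b])
    qed (use L vZ x in \<open>auto simp: large_def\<close>)
    then show ?thesis using vM[of x] x by auto
  qed
  then show ?thesis by blast
qed

text \<open>Two stages: a barrier blowing up at \<open>\<rho> < R\<close>, the same for all
  \<open>lam \<le> 0\<close>, bounds every solution at \<open>b'\<close> by \<open>Q\<close>; the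
  hyperbolic supersolution then propagates this bound inwards and decays like
  \<open>exp (- k * (b' - b))\<close> on \<open>[0,b]\<close>.\<close>

lemma large_upper_bound:
  assumes b: "0 < b" "b < R" and "0 < e"
  shows "\<forall>\<^sub>F lam in at_bot. \<forall>L V. large lam R L V \<longrightarrow> (\<forall>x\<in>{0..b}. L x < e)"
proof -
  define b' where "b' = (b + R) / 2"
  define \<rho> where "\<rho> = (b' + R) / 2"
  have b': "b < b'" "b' < \<rho>" "\<rho> < R" "0 < b'" "0 < \<rho>" using b by (simp_all add: b'_def \<rho>_def field_simps)
  obtain W where W: "\<forall>lam b. lam \<le> 0 \<longrightarrow> 0 < b \<longrightarrow> b < \<rho> \<longrightarrow> b \<le> R \<longrightarrow> super lam b W"
    "filterlim W at_top (at_left \<rho>)" "\<forall>x\<in>{0..<\<rho>}. 0 < W x"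
    using exists_blowup_super[of \<rho> 0 0] b' R by auto
  define Q where "Q = W b'"
  have Q: "0 < Q" using W(3) b' by (auto simp: Q_def)
  define Z where "Z lam = Q * exp (- (sqrt (- lam) * b')) * (exp (sqrt (- lam) * b) + 3)" for lam
  have "((\<lambda>k. Q * exp (- (k * b')) * (exp (k * b) + 3)) \<longlongrightarrow> 0) at_top"
    using b b' by real_asymp
  moreover have sqrt_lim: "filterlim (\<lambda>lam::real. sqrt (- lam)) at_top at_bot" by real_asymp
  ultimately have "(Z \<longlongrightarrow> 0) at_bot"
    unfolding Z_def by (rule filterlim_compose)
  then have ev1: "\<forall>\<^sub>F lam in at_bot. Z lam < e" using \<open>0 < e\<close> by (rule order_tendstoD)
  from sqrt_lim have ev2: "\<forall>\<^sub>F lam in at_bot. 2 * \<bar>c\<bar> \<le> sqrt (- lam)" by (simp add: filterlim_at_top)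
  have ev3: "\<forall>\<^sub>F lam::real in at_bot. lam \<le> 0" by (rule eventually_le_at_bot)
  from ev1 ev2 ev3 show ?thesis
  proof eventually_elim
    case (elim lam)
    define k where "k = sqrt (- lam)"
    have k: "2 * \<bar>c\<bar> \<le> k" "0 \<le> k" "k\<^sup>2 = - lam" using elim by (auto simp: k_def)
    \<comment> \<open>Normalised so that \<open>z b' \<ge> Q\<close>.\<close>
    define A where "A = Q * exp (- (k * b'))"
    have A: "0 < A" using Q by (simp add: A_def)
    \<comment> \<open>The weight 3 gives \<open>z' 0 = - 2 * A * k\<close> and
      \<open>z 0 = 4 * A\<close>, so the boundary inequality reads
      \<open>- 2 * k \<le> 4 * c\<close> and holds even for negative \<open>c\<close> once
      \<open>k\<close> is large.\<close>
    define z where "z x = A * (exp (k * x) + 3 * exp (- (k * x)))" for x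
    define z' where "z' x = A * k * (exp (k * x) - 3 * exp (- (k * x)))" for x
    have zp: "0 < z x" for x unfolding z_def using A by (intro mult_pos_pos add_pos_pos) auto
    have C: "C2_derivs b' z z' (\<lambda>x. k\<^sup>2 * z x)"
      unfolding C2_derivs_def z_def[abs_def] z'_def[abs_def]
      by (intro ballI conjI; (rule derivative_eq_intros refl)+) (simp_all add: algebra_simps power2_eq_square)
    have zF: "k\<^sup>2 * z x \<le> F lam x (z x)" if "x \<in> {0..b'}" for x
    proof -
      have "0 \<le> a x * \<bar>z x\<bar> powr (p - 1)" using a_pos[of x] that b' by auto
      then show ?thesis unfolding F_def using k zp[of x] by (intro mult_right_mono) auto
    qed
    have bc: "d * z' 0 \<le> c * z 0"
      using cd
    proof
      assume "d = 1"
      have "A * (- (2 * k)) \<le> A * (4 * c)" using A k by (intro mult_left_mono) auto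
      then show ?thesis using \<open>d = 1\<close> by (simp add: z_def z'_def mult_ac)
    next
      assume "d = 0 \<and> c = 1" then show ?thesis using zp[of 0] by simp
    qed
    have super: "super lam b' z" unfolding super_def
      using C zp zF bc by (intro exI[of _ z'] exI[of _ "\<lambda>x. k\<^sup>2 * z x"]) (auto simp: less_imp_le)
    show ?case
    proof (intro allI impI ballI)
      fix L V x assume L: "large lam R L V" and x: "x \<in> {0..b}"
      have S: "sol lam y L V" if "0 < y" "y \<le> \<rho>" for y using L that b' by (auto simp: large_def)
      obtain C where C: "\<forall>x\<in>{0..\<rho>}. L x \<le> C" using sol_bounded[OF S[of \<rho>]] b' by blast
      have "L b' \<le> W b'"
      proof (rule sub_le_blowup_super[of \<rho> lam L C W])
        show "sub lam y L" if "0 < y" "y < \<rho>" for y using sol_imp_sub[OF S] that by auto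
        show "super lam y W" if "0 < y" "y < \<rho>" for y using W(1) elim(3) that b' by auto
      qed (use W C b' in auto)
      also have "\<dots> = A * exp (k * b')" by (simp add: A_def Q_def exp_minus field_simps)
      also have "\<dots> \<le> z b'" unfolding z_def using A by (intro mult_left_mono) auto
      finally have "L b' \<le> z b'" .
      then have "L x \<le> z x"
        using sub_le_super[OF sol_imp_sub[OF S[of b']] super, of x] x b' by auto
      also have "z x \<le> A * (exp (k * b) + 3)"
        unfolding z_def using A k x by (intro mult_left_mono add_mono) (auto intro: mult_left_mono)
      also have "\<dots> = Z lam" by (simp add: A_def Z_def k_def)
      also have "\<dots> < e" by (rule elim(1))
      finally show "L x < e" .
    qed
  qed
qed

section \<open>Uniqueness for non-increasing weights\<close>


text \<open>With \<open>q powr (p - 1) = s^2\<close>, the function \<open>q * L' (s * y)\<close>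
  solves the problem with weight \<open>a (s * y)\<close>, parameter \<open>lam * s^2\<close> and,
  in the Robin case, coefficient \<open>s * c\<close>. The hypotheses turn all three changes in the
  supersolution direction: \<open>a (s * y) \<le> a y\<close>, \<open>lam \<le> lam * s^2\<close>
  and \<open>s * c \<le> c\<close>.\<close>

lemma large_unique_le:
  assumes a: "antimono_on {0..R} a" and "0 \<le> lam" and c: "d = 0 \<or> c \<le> 0"
    and L: "large lam R L V" and L': "large lam R L' V'" and x: "x \<in> {0..<R}"
  shows "L x \<le> L' x"
proof -
  define g where "g = 2 / (p - 1)"
  have scaled: "L x \<le> s powr g * L' (s * x)" if s: "1 < s" "s * x < R" for s
  proof -
    define q where "q = s powr g"
    define w where "w y = q * L' (s * y)" for y
    have "g * (p - 1) = 2" using p by (auto simp: g_def field_simps)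
    then have q: "0 < q" "q powr (p - 1) = s\<^sup>2"
      using s by (simp_all add: q_def powr_powr)
    have r: "0 < R / s" "R / s < R" "x < R / s" using s R by (auto simp: field_simps)
    have super: "super lam b w" if b: "0 < b" "b < R / s" for b
    proof -
      have sb: "0 < s * b" "s * b < R" using b s by (auto simp: field_simps)
      have S: "sol lam (s * b) L' V'" using L' sb by (auto simp: large_def)
      have W: "\<forall>y\<in>{0..s*b}. 0 \<le> L' y \<and> (0 < y \<longrightarrow> 0 < L' y)"
        using large_imp_super[OF L' order_refl sb] unfolding super_def by blast
      have sub: "(*) s ` {0..b} \<subseteq> {0..s * b}" using s by (auto intro: mult_left_mono)
      have mem: "s * y \<in> {0..s * b}" if "y \<in> {0..b}" for y using sub that by blast
      have chain: "((\<lambda>y. h (s * y)) has_real_derivative k (s * y) * s) (at y within {0..b})"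
        if h: "\<And>z. z \<in> {0..s * b} \<Longrightarrow> (h has_real_derivative k z) (at z within {0..s * b})" and y: "y \<in> {0..b}"
        for h k y
      proof -
        have "(h has_real_derivative k (s * y)) (at (s * y) within (*) s ` {0..b})"
          using y by (intro DERIV_subset[OF h sub] mem)
        moreover have "((*) s has_real_derivative s) (at y within {0..b})"
          by (auto intro!: derivative_eq_intros)
        ultimately show ?thesis
          using DERIV_image_chain[of h "k (s * y)" "(*) s" y "{0..b}" s] by (simp add: o_def)
      qed
      define w' where "w' y = q * (V' (s * y) * s)" for y
      define w'' where "w'' y = q * (F lam (s * y) (L' (s * y)) * s * s)" for y
      have C: "C2_derivs b w w' w''"
        unfolding C2_derivs_def
      proof (intro ballI conjI)
        fix y assume y: "y \<in> {0..b}"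
        show "(w has_real_derivative w' y) (at y within {0..b})"
          unfolding w_def[abs_def] w'_def using S y
          by (intro DERIV_cmult chain) (auto simp: sol_def C2_derivs_def)
        show "(w' has_real_derivative w'' y) (at y within {0..b})"
          unfolding w'_def[abs_def] w''_def using S y
          by (intro DERIV_cmult DERIV_cmult_right chain[of V' "\<lambda>z. F lam z (L' z)"])
            (auto simp: sol_def C2_derivs_def)
      qed
      have le: "w'' y \<le> F lam y (w y)" if y: "y \<in> {0..b}" for y
      proof -
        define l where "l = L' (s * y)"
        have sy: "s * y \<in> {0..s * b}" by (rule mem[OF y])
        then have "0 \<le> s * y" "s * y \<le> R" using sb(2) unfolding atLeastAtMost_iff by linarith+
        moreover have "y \<le> s * y" "0 \<le> y" using y s by (auto simp: mult_le_cancel_right1)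
        ultimately have sR: "s * y \<in> {0..R}" "y \<in> {0..R}" "y \<le> s * y"
          unfolding atLeastAtMost_iff by linarith+
        have l: "0 \<le> l" using W sy by (auto simp: l_def)
        have "a (s * y) \<le> a y" using a sR by (auto simp: monotone_on_def)
        then have "(s\<^sup>2 * l powr (p - 1)) * a (s * y) \<le> (s\<^sup>2 * l powr (p - 1)) * a y"
          by (intro mult_left_mono) auto
        moreover have "lam * 1 \<le> lam * s\<^sup>2"
          using s \<open>0 \<le> lam\<close> by (intro mult_left_mono) (auto simp: one_le_power less_imp_le)
        ultimately have "(a (s * y) * l powr (p - 1) - lam) * s\<^sup>2 \<le> a y * (s\<^sup>2 * l powr (p - 1)) - lam"
          by (simp add: algebra_simps)
        then have "(a (s * y) * l powr (p - 1) - lam) * s\<^sup>2 * (q * l) \<le> (a y * (s\<^sup>2 * l powr (p - 1)) - lam) * (q * l)"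
          using q l by (intro mult_right_mono) auto
        moreover have "\<bar>q * l\<bar> powr (p - 1) = s\<^sup>2 * l powr (p - 1)"
          using q l by (simp add: powr_mult)
        ultimately show ?thesis using l
          by (simp add: w''_def w_def F_def power2_eq_square mult_ac flip: l_def)
      qed
      have bc: "d * w' 0 \<le> c * w 0"
      proof -
        have bc': "d * V' 0 = c * L' 0" using S by (simp add: sol_def)
        have l: "0 \<le> q * L' 0" using W sb q by auto
        show ?thesis
        proof (cases "d = 0")
          case True
          then show ?thesis using cd l by (auto simp: w_def)
        next
          case False
          then have "c \<le> 0" using c by simp
          then have "s * c \<le> 1 * c" using s by (intro mult_right_mono_neg) auto
          then have "(s * c) * (q * L' 0) \<le> c * (q * L' 0)" using l by (intro mult_right_mono) auto
          moreover have "d * w' 0 = (s * c) * (q * L' 0)" using bc' by (simp add: w'_def mult_ac)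
          ultimately show ?thesis by (simp add: w_def)
        qed
      qed
      have pos: "\<forall>y\<in>{0..b}. 0 \<le> w y \<and> (0 < y \<longrightarrow> 0 < w y) \<and> w'' y \<le> F lam y (w y)"
      proof
        fix y assume y: "y \<in> {0..b}"
        then have "s * y \<in> {0..s * b}" by (rule mem)
        moreover have "0 < y \<longrightarrow> 0 < s * y" using s by simp
        ultimately show "0 \<le> w y \<and> (0 < y \<longrightarrow> 0 < w y) \<and> w'' y \<le> F lam y (w y)"
          using W le[OF y] q by (auto simp: w_def)
      qed
      show ?thesis unfolding super_def using C bc pos by blast
    qed
    have blow: "filterlim w at_top (at_left (R / s))"
    proof -
      have "filterlim (\<lambda>y. s * y) (at_left R) (at_left (R / s))"
      proof (rule filterlim_at_withinI)
        have "((\<lambda>y. s * y) \<longlongrightarrow> s * (R / s)) (at_left (R / s))" by (intro tendsto_intros)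
        then show "((\<lambda>y. s * y) \<longlongrightarrow> R) (at_left (R / s))" using s by simp
        show "\<forall>\<^sub>F y in at_left (R / s). s * y \<in> {..<R} - {R}"
          using r s by (intro eventually_at_leftI[of 0]) (auto simp: field_simps)
      qed
      moreover have "filterlim L' at_top (at_left R)" using L' by (simp add: large_def)
      ultimately have "filterlim (\<lambda>y. L' (s * y)) at_top (at_left (R / s))"
        by (rule filterlim_compose[rotated])
      then show ?thesis unfolding w_def
        by (intro filterlim_tendsto_pos_mult_at_top[OF tendsto_const]) (use q in auto)
    qed
    have S: "sol lam y L V" if "0 < y" "y \<le> R / s" for y using L that r by (auto simp: large_def)
    obtain C where C: "\<forall>x\<in>{0..R / s}. L x \<le> C" using sol_bounded[OF S[of "R / s"]] r by blast
    have "L x \<le> w x"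
    proof (rule sub_le_blowup_super[of "R / s" lam L C w])
      show "sub lam y L" if "0 < y" "y < R / s" for y using sol_imp_sub[OF S] that by auto
    qed (use super blow C r x in auto)
    then show ?thesis by (simp add: w_def q_def)
  qed
  \<comment> \<open>Dilations tending to 1 from above; since \<open>x < R\<close>, the points
    \<open>s n * x\<close> eventually stay in an interval \<open>[0,b]\<close> with
    \<open>b < R\<close>, where \<open>L'\<close> is continuous.\<close>
  define s where "s n = 1 + 1 / real (Suc n)" for n
  have s1: "1 < s n" for n by (simp add: s_def)
  have s_lim: "s \<longlonglongrightarrow> 1" unfolding s_def by real_asymp
  define b where "b = (x + R) / 2"
  have b: "0 < b" "x < b" "b < R" using x R by (auto simp: b_def)
  have sx_lim: "(\<lambda>n. s n * x) \<longlonglongrightarrow> x" using tendsto_mult_right[OF s_lim, of x] by simp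
  then have ev: "\<forall>\<^sub>F n in sequentially. s n * x < b" using b by (intro order_tendstoD)
  have "sol lam b L' V'" using L' b by (auto simp: large_def)
  then have "continuous_on {0..b} L'" using C2_derivs_continuous(1) unfolding sol_def by blast
  moreover have "\<forall>\<^sub>F n in sequentially. s n * x \<in> {0..b}"
    using ev by eventually_elim (use x in \<open>auto simp: s_def\<close>)
  ultimately have "(\<lambda>n. L' (s n * x)) \<longlonglongrightarrow> L' x"
    using sx_lim x b by (intro continuous_on_tendsto_compose[of "{0..b}" L']) auto
  moreover have "(\<lambda>n. s n powr g) \<longlonglongrightarrow> 1 powr g" by (intro tendsto_intros s_lim) auto
  ultimately have "(\<lambda>n. s n powr g * L' (s n * x)) \<longlonglongrightarrow> 1 powr g * L' x"
    by (intro tendsto_mult)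
  moreover have "\<forall>\<^sub>F n in sequentially. L x \<le> s n powr g * L' (s n * x)"
    using ev by eventually_elim (use scaled s1 b in auto)
  ultimately have "L x \<le> 1 powr g * L' x"
    by (intro tendsto_lowerbound) auto
  then show ?thesis by simp
qed

section \<open>Translation into the stated boundary value problem\<close>

lemma positive_solution_iff_large:
  assumes B: "\<And>u. B u = 0 \<longleftrightarrow> d * D1 R u 0 = c * u 0"
  shows "positive_solution R p a B lam u \<longleftrightarrow> (\<exists>v. large lam R u v)"
proof
  assume u: "positive_solution R p a B lam u"
  have ode: "D2 R u x = F lam x (u x)" if "x \<in> {0..<R}" for x
    using u that by (auto simp: positive_solution_def F_def algebra_simps)
  have d1: "(u has_real_derivative D1 R u x) (at x within {0..<R})" if "x \<in> {0..<R}" for x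
    using u that vector_derivative_works[of u "at x within {0..<R}"]
    by (auto simp: positive_solution_def C2_on_def differentiable_on_def D1_def
        has_real_derivative_iff_has_vector_derivative)
  have d2: "(D1 R u has_real_derivative F lam x (u x)) (at x within {0..<R})" if "x \<in> {0..<R}" for x
    using u that vector_derivative_works[of "D1 R u" "at x within {0..<R}"] ode[OF that]
    by (auto simp: positive_solution_def C2_on_def differentiable_on_def D2_def D1_def[of R "D1 R u"]
        has_real_derivative_iff_has_vector_derivative)
  have "large lam R u (D1 R u)" unfolding large_def sol_def C2_derivs_def
  proof (intro conjI allI impI ballI)
    fix b x assume b: "0 < b" "b < R" and x: "x \<in> {0..b}"
    then have s: "{0..b} \<subseteq> {0..<R}" "x \<in> {0..<R}" by auto
    show "(u has_real_derivative D1 R u x) (at x within {0..b})" by (rule DERIV_subset[OF d1[OF s(2)] s(1)])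
    show "(D1 R u has_real_derivative F lam x (u x)) (at x within {0..b})" by (rule DERIV_subset[OF d2[OF s(2)] s(1)])
    show "0 \<le> u x" using u s by (auto simp: positive_solution_def)
  next
    show "d * D1 R u 0 = c * u 0" using u B by (simp add: positive_solution_def)
    show "filterlim u at_top (at_left R)" using u by (simp add: positive_solution_def)
  qed
  then show "\<exists>v. large lam R u v" by (rule exI[of "large lam R u"])
next
  assume "\<exists>v. large lam R u v"
  then obtain v where v: "large lam R u v" ..
  \<comment> \<open>For \<open>b\<close> strictly between \<open>x\<close> and \<open>R\<close> the
    sets \<open>{0..<R}\<close> and \<open>{0..b}\<close> agree near \<open>x\<close>, so both
    notions of derivative coincide, including the one-sided one at 0.\<close>
  have at: "\<exists>b. 0 < b \<and> b < R \<and> x \<in> {0..b} \<and> at x within {0..<R} = at x within {0..b} \<and> sol lam b u v"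
    if x: "x \<in> {0..<R}" for x
  proof -
    define b where "b = (x + R) / 2"
    have b: "0 < b" "x < b" "b < R" using x R by (auto simp: b_def)
    then have "at x within {0..<R} = at x within {0..b}"
      by (intro at_within_nhd[of x "{..<b}"]) auto
    then show ?thesis using b v x by (intro exI[of _ b]) (auto simp: large_def)
  qed
  have d1: "(u has_real_derivative v x) (at x within {0..<R})"
    and d2: "(v has_real_derivative F lam x (u x)) (at x within {0..<R})"
    and nonneg: "0 \<le> u x" if "x \<in> {0..<R}" for x
    using at[OF that] by (auto simp: sol_def C2_derivs_def)
  have vd: "vector_derivative f (at x within {0..<R}) = f'"
    if x: "x \<in> {0..<R}" and f: "(f has_real_derivative f') (at x within {0..<R})" for f f' x
  proof -
    obtain b where "0 < b" "x \<in> {0..b}" "at x within {0..<R} = at x within {0..b}"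
      using at[OF x] by blast
    then show ?thesis using f vector_derivative_within_cbox[of 0 b x f f']
      by (auto simp: has_real_derivative_iff_has_vector_derivative)
  qed
  have D1: "D1 R u x = v x" if "x \<in> {0..<R}" for x
    unfolding D1_def by (rule vd[OF that d1[OF that]])
  have d2': "(D1 R u has_real_derivative F lam x (u x)) (at x within {0..<R})" if "x \<in> {0..<R}" for x
    by (rule has_field_derivative_transform_within[OF d2[OF that] zero_less_one that]) (simp add: D1)
  have D2: "D2 R u x = F lam x (u x)" if "x \<in> {0..<R}" for x
    unfolding D2_def D1_def[of R "D1 R u"] by (rule vd[OF that d2'[OF that]])
  have "C2_on R u"
    unfolding C2_on_def
  proof (intro conjI)
    show "u differentiable_on {0..<R}" "D1 R u differentiable_on {0..<R}"
      unfolding differentiable_on_def real_differentiable_def using d1 d2' by blast+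
    have "continuous_on {0..<R} (\<lambda>x. F lam x (u x))"
      by (rule F_continuous_on[OF DERIV_continuous_on[OF d1]]) auto
    then show "continuous_on {0..<R} (D2 R u)"
      by (rule continuous_on_eq) (simp add: D2)
  qed
  moreover have "- D2 R u x = lam * u x - a x * \<bar>u x\<bar> powr (p - 1) * u x" if "x \<in> {0..<R}" for x
    using D2[OF that] by (simp add: F_def algebra_simps)
  moreover have "B u = 0"
  proof -
    have "sol lam (R / 2) u v" using v R by (auto simp: large_def)
    then show ?thesis using D1[of 0] R B by (simp add: sol_def)
  qed
  moreover have lim: "filterlim u at_top (at_left R)" using v by (simp add: large_def)
  moreover have "\<exists>x\<in>{0..<R}. u x \<noteq> 0"
  proof -
    obtain y where "0 < y" "y < R" "1 \<le> u y" using at_top_at_left_witness[OF lim R] by blast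
    then show ?thesis by (intro bexI[of _ y]) auto
  qed
  ultimately show "positive_solution R p a B lam u"
    using nonneg by (simp add: positive_solution_def)
qed

end

lemma compact_subset_Ico_bound:
  fixes K :: "real set"
  assumes "compact K" "K \<subseteq> {0..<R}" "0 < R"
  obtains b where "0 < b" "b < R" "K \<subseteq> {0..b}"
proof (cases "K = {}")
  case True then show thesis using assms by (intro that[of "R / 2"]) auto
next
  case False
  then obtain t where t: "t \<in> K" "\<forall>x\<in>K. x \<le> t"
    using compact_attains_sup[OF assms(1)] by blast
  then have "t < R" "0 \<le> t" using assms by auto
  then show thesis using t assms by (intro that[of "(t + R) / 2"]) force+
qed

text \<open>\<open>B\<close> is given only as a functional. Trying the Dirichlet operator first and
  then a Robin form with \<open>\<beta> \<le> 0\<close> (which covers Neumann) secures the sign of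
  \<open>c\<close> without having to show that \<open>B\<close> determines
  \<open>\<beta>\<close>.\<close>

lemma boundary_operator_cases:
  assumes "B \<in> {dirichlet, neumann R} \<union> {robin R \<beta> | \<beta>. True}"
  shows "\<exists>c d. (d = 1 \<or> d = 0 \<and> c = 1) \<and> (\<forall>u. B u = 0 \<longleftrightarrow> d * D1 R u 0 = c * u 0) \<and>
    (B \<noteq> dirichlet \<longrightarrow> d = 1) \<and>
    (B \<in> {dirichlet, neumann R} \<union> {robin R \<beta> | \<beta>. \<beta> < 0} \<longrightarrow> d = 0 \<or> c \<le> 0)"
proof (cases "B = dirichlet")
  case True
  then show ?thesis by (intro exI[of _ 1] exI[of _ 0]) (auto simp: dirichlet_def)
next
  case False
  show ?thesis
  proof (cases "\<exists>\<beta>\<le>0. B = robin R \<beta>")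
    case True
    then obtain \<beta> where "\<beta> \<le> 0" "B = robin R \<beta>" by blast
    then show ?thesis by (intro exI[of _ \<beta>] exI[of _ 1]) (auto simp: robin_def)
  next
    case robin: False
    then have "B \<noteq> neumann R" using robin_0[of R] by (metis order_refl)
    with assms False obtain \<beta> where \<beta>: "B = robin R \<beta>" by blast
    have "B \<notin> {dirichlet, neumann R} \<union> {robin R \<beta> | \<beta>. \<beta> < 0}"
      using False robin \<open>B \<noteq> neumann R\<close> by (auto dest: less_imp_le)
    then show ?thesis using \<beta> by (intro exI[of _ \<beta>] exI[of _ 1]) (auto simp: robin_def)
  qed
qed

theorem theorem1p2:
  fixes R p :: real and a :: "real \<Rightarrow> real" and B :: "(real \<Rightarrow> real) \<Rightarrow> real"
  assumes "R > 0" and "p > 1"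
    and "continuous_on {0..R} a" and "\<forall>x\<in>{0..R}. a x > 0"
    and "B \<in> {dirichlet, neumann R} \<union> {robin R \<beta> | \<beta>. True}"
  shows "\<exists>Lmin Lmax :: real \<Rightarrow> real \<Rightarrow> real.
    (\<forall>lam. minimal_solution R p a B lam (Lmin lam) \<and> maximal_solution R p a B lam (Lmax lam)) \<and>
    (B \<noteq> dirichlet \<longrightarrow>
      (\<forall>K. compact K \<and> K \<subseteq> {0..<R} \<longrightarrow> uniformly_to_infinity K Lmin at_top)) \<and>
    (B = dirichlet \<longrightarrow> (\<forall>lam. Lmin lam 0 = 0)) \<and>
    (\<forall>K. compact K \<and> K \<subseteq> {0..<R} \<longrightarrow> uniform_limit K Lmax (\<lambda>x. 0) at_bot) \<and>
    (antimono_on {0..R} a \<and> B \<in> {dirichlet, neumann R} \<union> {robin R \<beta> | \<beta>. \<beta> < 0} \<longrightarrow>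
      (\<forall>lam\<ge>0. (\<forall>x\<in>{0..<R}. Lmin lam x = Lmax lam x) \<and>
        (\<forall>L. positive_solution R p a B lam L \<longrightarrow> (\<forall>x\<in>{0..<R}. L x = Lmin lam x))))"
proof -
  obtain c d :: real where cd: "d = 1 \<or> d = 0 \<and> c = 1" and B: "\<forall>u. B u = 0 \<longleftrightarrow> d * D1 R u 0 = c * u 0"
    and d1: "B \<noteq> dirichlet \<longrightarrow> d = 1"
    and c: "B \<in> {dirichlet, neumann R} \<union> {robin R \<beta> | \<beta>. \<beta> < 0} \<longrightarrow> d = 0 \<or> c \<le> 0"
    using boundary_operator_cases[OF assms(5)] by blast
  interpret blowup_problem R p a c d
    using assms(1-4) cd by unfold_locales auto
  note pos_iff = positive_solution_iff_large[of B, OF B[rule_format]]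
  have "\<exists>u. minimal_solution R p a B lam u" for lam
  proof -
    obtain u v where u: "large lam R u v"
      "\<forall>w. (\<forall>b. 0 < b \<longrightarrow> b < R \<longrightarrow> super lam b w) \<longrightarrow> filterlim w at_top (at_left R) \<longrightarrow> (\<forall>x\<in>{0..<R}. u x \<le> w x)"
      using exists_minimal_large[of R lam] R by blast
    \<comment> \<open>Every solution is a supersolution on each \<open>[0,b]\<close>, so minimality
      against supersolutions applies to it.\<close>
    have "u x \<le> L x" if "large lam R L V" "x \<in> {0..<R}" for L V x
      using u(2) large_imp_super[OF that(1) order_refl] that by (auto simp: large_def)
    then show ?thesis using u(1) unfolding minimal_solution_def pos_iff by blast
  qed
  then obtain Lmin where Lmin: "\<And>lam. minimal_solution R p a B lam (Lmin lam)" by metis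
  have "\<exists>u. maximal_solution R p a B lam u" for lam
    using exists_maximal_large[of lam] unfolding maximal_solution_def pos_iff by blast
  then obtain Lmax where Lmax: "\<And>lam. maximal_solution R p a B lam (Lmax lam)" by metis
  have min_large: "\<exists>v. large lam R (Lmin lam) v" for lam
    using Lmin[of lam] unfolding minimal_solution_def pos_iff by blast
  have max_large: "\<exists>v. large lam R (Lmax lam) v" for lam
    using Lmax[of lam] unfolding maximal_solution_def pos_iff by blast
  have max_nonneg: "0 \<le> Lmax lam x" if "x \<in> {0..<R}" for lam x
    using Lmax[of lam] that by (simp add: maximal_solution_def positive_solution_def)
  show ?thesis
  proof (rule exI[of _ Lmin], rule exI[of _ Lmax], intro conjI allI impI)
    fix K assume "B \<noteq> dirichlet" and K: "compact K \<and> K \<subseteq> {0..<R}"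
    show "uniformly_to_infinity K Lmin at_top"
      unfolding uniformly_to_infinity_def
    proof
      fix M
      obtain \<Lambda> where \<Lambda>: "\<forall>lam\<ge>\<Lambda>. \<forall>L V. large lam R L V \<longrightarrow> (\<forall>x\<in>{0..<R}. M \<le> L x)"
        using large_lower_bound[OF mp[OF d1 \<open>B \<noteq> dirichlet\<close>]] by blast
      show "\<forall>\<^sub>F lam in at_top. \<forall>x\<in>K. M \<le> Lmin lam x"
        using eventually_ge_at_top[of \<Lambda>]
        by eventually_elim (use \<Lambda> min_large K in blast)
    qed
  next
    fix lam assume "B = dirichlet"
    then show "Lmin lam 0 = 0"
      using Lmin[of lam] by (simp add: minimal_solution_def positive_solution_def dirichlet_def)
  next
    fix K assume K: "compact K \<and> K \<subseteq> {0..<R}"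
    then obtain b where b: "0 < b" "b < R" "K \<subseteq> {0..b}"
      using compact_subset_Ico_bound R by blast
    show "uniform_limit K Lmax (\<lambda>x. 0) at_bot"
      unfolding uniform_limit_iff
    proof (intro allI impI)
      fix e :: real assume "0 < e"
      have "\<forall>x\<in>K. dist (Lmax lam x) 0 < e"
        if "\<forall>L V. large lam R L V \<longrightarrow> (\<forall>x\<in>{0..b}. L x < e)" for lam
      proof
        fix x assume "x \<in> K"
        then have x: "x \<in> {0..b}" "x \<in> {0..<R}" using b K by auto
        with that max_large[of lam] have "Lmax lam x < e" by blast
        with max_nonneg[OF x(2), of lam] show "dist (Lmax lam x) 0 < e" by simp
      qed
      then show "\<forall>\<^sub>F lam in at_bot. \<forall>x\<in>K. dist (Lmax lam x) 0 < e"
        using large_upper_bound[OF b(1,2) \<open>0 < e\<close>] by (rule eventually_mono[rotated])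
    qed
  next
    fix lam :: real
    assume a: "antimono_on {0..R} a \<and> B \<in> {dirichlet, neumann R} \<union> {robin R \<beta> | \<beta>. \<beta> < 0}" and lam: "0 \<le> lam"
    from a c have c': "d = 0 \<or> c \<le> 0" by blast
    have eq: "L x = L' x" if "large lam R L V" "large lam R L' V'" "x \<in> {0..<R}" for L V L' V' x
      using large_unique_le[OF _ lam c', of L V L' V' x] large_unique_le[OF _ lam c', of L' V' L V x] a that
      by (intro antisym) auto
    show "\<forall>x\<in>{0..<R}. Lmin lam x = Lmax lam x" using eq min_large max_large by blast
    show "\<forall>x\<in>{0..<R}. L x = Lmin lam x" if "positive_solution R p a B lam L" for L
      using eq min_large that unfolding pos_iff by blast
  qed (use Lmin Lmax in auto)
qed

end
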